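(* Let $f=0$ be a reduced local equation at $0$ of a divisor $(D,0)\subset(\mathbf{C}^n,0)$, and let $-\alpha_0$ be the least integer root of the $b$-function of $f$. Then $$\mathcal{O}[*D]\simeq \widetilde{M}^{(\alpha_0)\log D}\ \text{ as left } \mathcal{D}\text{-modules}\quad\Longleftrightarrow\quad \mathrm{Ann}_{\mathcal{D}}(1/f^{\alpha_0})=\widetilde{I}^{(\alpha_0)\log D}.$$
   Context: Everything is local at $0\in\mathbf{C}^n$. $\mathcal{O}=\mathcal{O}_{\mathbf{C}^n,0}$ is the ring of germs at $0$ of holomorphic functions, and $\mathcal{D}$ is the ring of germs at $0$ of linear differential operators with holomorphic coefficients, i.e. finite sums $\sum_\alpha a_\alpha\partial^\alpha$ with $a_\alpha\in\mathcal{O}$, $\partial_i=\partial/\partial x_i$. A divisor $D$ is a hypersurface; here $0\in D$ and $f\in\mathcal{O}$ (with $f(0)=0$, $f\ne 0$) is a reduced equation of the germ $(D,0)$. $\mathcal{O}[*D]=\mathcal{O}[1/f]$ is the left $\mathcal{D}$-module of germs at $0$ of meromorphic functions with poles along $D$. $\mathrm{Ann}_{\mathcal{D}}(1/f^k)$ is the left ideal of operators $P\in\mathcal{D}$ with $P(1/f^k)=0$ in $\mathcal{O}[*D]$. The $b$-function (Bernstein–Sato polynomial) of $f$ is the monic polynomial $b(s)\in\mathbf{C}[s]$ of least degree for which there is $P(s)\in\mathcal{D}[s]$ with $P(s)f^{s+1}=b(s)f^s$. $\mathrm{Der}(\log D)$ is the $\mathcal{O}$-module of germs at $0$ of holomorphic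 vector fields ($\mathbf{C}$-derivations of $\mathcal{O}$) $\delta$ with $\delta(f)=af$ for some $a\in\mathcal{O}$. For an integer $k\ge1$, $\widetilde{I}^{(k)\log D}\subset\mathcal{D}$ is the left ideal generated by the set $\{\delta+ka \mid \delta\in \mathrm{Der}(\log D),\ \delta(f)=af\}$, and $\widetilde{M}^{(k)\log D}=\mathcal{D}/\widetilde{I}^{(k)\log D}$. *)

theory Defs
  imports
    "HOL-Complex_Analysis.Complex_Analysis"
    "HOL-Computational_Algebra.Computational_Algebra"
    "HOL-Algebra.Module"
    "HOL-Algebra.Ideal"
begin

no_notation fps_nth (infixl \<open>$\<close> 75)

section \<open>Holomorphic functions of several complex variables\<close>

definition complex_differentiable_at :: "(complex ^ 'n::finite \<Rightarrow> complex) \<Rightarrow> complex ^ 'n \<Rightarrow> bool" where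
  "complex_differentiable_at f z \<longleftrightarrow>
     (\<exists>L. (f has_derivative L) (at z) \<and> (\<forall>c v. L (c *s v) = c * L v))"

definition holomorphic_near0 :: "(complex ^ 'n::finite \<Rightarrow> complex) \<Rightarrow> bool" where
  "holomorphic_near0 f \<longleftrightarrow> (\<forall>\<^sub>F z in nhds 0. complex_differentiable_at f z)"

definition pderiv_at :: "'n \<Rightarrow> (complex ^ 'n::finite \<Rightarrow> complex) \<Rightarrow> complex ^ 'n \<Rightarrow> complex" where
  "pderiv_at i f z = deriv (\<lambda>t. f (z + axis i t)) 0"

lemma cdiff_const: "complex_differentiable_at (\<lambda>_. c) z"
  unfolding complex_differentiable_at_def by (rule exI[of _ "\<lambda>_. 0"]) auto

lemma cdiff_add:
  assumes "complex_differentiable_at f z" "complex_differentiable_at g z"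
  shows "complex_differentiable_at (\<lambda>z. f z + g z) z"
proof -
  obtain L M where "(f has_derivative L) (at z)" "\<And>c v. L (c *s v) = c * L v"
    "(g has_derivative M) (at z)" "\<And>c v. M (c *s v) = c * M v"
    using assms unfolding complex_differentiable_at_def by blast
  then show ?thesis unfolding complex_differentiable_at_def
    by (intro exI[of _ "\<lambda>v. L v + M v"]) (auto intro!: derivative_eq_intros simp: algebra_simps)
qed

lemma cdiff_minus:
  assumes "complex_differentiable_at f z"
  shows "complex_differentiable_at (\<lambda>z. - f z) z"
proof -
  obtain L where "(f has_derivative L) (at z)" "\<And>c v. L (c *s v) = c * L v"
    using assms unfolding complex_differentiable_at_def by blast
  then show ?thesis unfolding complex_differentiable_at_def
    by (intro exI[of _ "\<lambda>v. - L v"]) (auto intro!: derivative_eq_intros)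
qed

lemma cdiff_mult:
  assumes "complex_differentiable_at f z" "complex_differentiable_at g z"
  shows "complex_differentiable_at (\<lambda>z. f z * g z) z"
proof -
  obtain L M where "(f has_derivative L) (at z)" "\<And>c v. L (c *s v) = c * L v"
    "(g has_derivative M) (at z)" "\<And>c v. M (c *s v) = c * M v"
    using assms unfolding complex_differentiable_at_def by blast
  then show ?thesis unfolding complex_differentiable_at_def
    by (intro exI[of _ "\<lambda>v. f z * M v + L v * g z"])
       (auto intro!: derivative_eq_intros simp: algebra_simps)
qed

lemma cdiff_coord: "complex_differentiable_at (\<lambda>z. z $ i) z"
  unfolding complex_differentiable_at_def
  by (intro exI[of _ "\<lambda>v. v $ i"])
     (auto intro!: bounded_linear_imp_has_derivative bounded_linear_vec_nth)

lemma axis_smult: "axis i t = t *s axis i (1::complex)"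
  by (simp add: vec_eq_iff axis_def)

lemma bounded_linear_axis: "bounded_linear (axis i :: complex \<Rightarrow> complex ^ 'n::finite)"
  unfolding linear_conv_bounded_linear[symmetric]
  by (rule linearI) (auto simp: vec_eq_iff axis_def)

lemma norm_axis_complex: "norm (axis i t :: complex ^ 'n::finite) = norm t"
proof -
  have "norm (axis i t :: complex ^ 'n) ^ 2 = norm t ^ 2"
    by (simp only: power2_norm_eq_inner inner_axis_axis) (simp add: power2_norm_eq_inner)
  then show ?thesis by (simp add: power2_eq_iff_nonneg)
qed

lemma cdiff_line:
  fixes z v :: "complex ^ 'n::finite"
  assumes "(f has_derivative L) (at (z + t *s v))" "\<And>c v. L (c *s v) = c * L v"
  shows "((\<lambda>t. f (z + t *s v)) has_field_derivative L v) (at t)"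
proof -
  have "bounded_linear (\<lambda>t::complex. t *s v)"
    unfolding linear_conv_bounded_linear[symmetric]
    by (rule linearI) (auto simp: vec_eq_iff algebra_simps)
  then have "((\<lambda>t. z + t *s v) has_derivative (\<lambda>t. t *s v)) (at t)"
    by (auto intro!: derivative_eq_intros bounded_linear_imp_has_derivative)
  from has_derivative_compose[OF this assms(1)] show ?thesis
    unfolding has_field_derivative_def by (simp add: assms(2) fun_eq_iff[symmetric] mult_commute_abs)
qed

lemma pderiv_at_eq:
  assumes "(f has_derivative L) (at z)" "\<And>c v. L (c *s v) = c * L v"
  shows "pderiv_at i f z = L (axis i 1)"
proof -
  have "((\<lambda>t. f (z + t *s axis i 1)) has_field_derivative L (axis i 1)) (at 0)"
    by (rule cdiff_line) (use assms in auto)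
  then show ?thesis unfolding pderiv_at_def axis_smult[of i, symmetric] by (rule DERIV_imp_deriv)
qed

lemma cdiff_has_derivative:
  assumes "complex_differentiable_at f z"
  shows "(f has_derivative (\<lambda>v. \<Sum>i\<in>UNIV. v $ i * pderiv_at i f z)) (at z)"
proof -
  obtain L where L: "(f has_derivative L) (at z)" "\<And>c v. L (c *s v) = c * L v"
    using assms unfolding complex_differentiable_at_def by blast
  have "L v = (\<Sum>i\<in>UNIV. v $ i * pderiv_at i f z)" for v
  proof -
    interpret L: bounded_linear L using L(1) by (rule has_derivative_bounded_linear)
    have "L v = L (\<Sum>i\<in>UNIV. v $ i *s axis i 1)" by (simp only: basis_expansion)
    also have "\<dots> = (\<Sum>i\<in>UNIV. v $ i * pderiv_at i f z)"
      by (simp add: L.sum L(2) pderiv_at_eq[OF L])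
    finally show ?thesis .
  qed
  then have "L = (\<lambda>v. \<Sum>i\<in>UNIV. v $ i * pderiv_at i f z)" by blast
  with L(1) show ?thesis by simp
qed

lemma pderiv_at_integral:
  fixes f :: "complex ^ 'n::finite \<Rightarrow> complex"
  assumes f: "\<And>z. z \<in> ball 0 R \<Longrightarrow> complex_differentiable_at f z"
    and r: "0 < r" "2 * r < R" and z: "z \<in> ball 0 r"
  defines "w \<equiv> \<lambda>x. of_real r * exp (2 * of_real pi * \<i> * of_real x)"
  shows "pderiv_at i f z = integral (cbox 0 1) (\<lambda>x. f (z + axis i (w x)) / w x)"
proof -
  define h where "h = (\<lambda>t. f (z + t *s axis i 1))"
  have in_ball: "z + t *s axis i 1 \<in> ball 0 R" if "norm t \<le> r" for t :: complex
    using norm_triangle_ineq[of z "t *s axis i 1"] z r that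
    by (simp add: axis_smult[of i t, symmetric] norm_axis_complex)
  have der: "\<exists>d. (h has_field_derivative d) (at t)" if "norm t \<le> r" for t
    using f[OF in_ball[OF that]] cdiff_line
    unfolding complex_differentiable_at_def h_def by metis
  have cont: "continuous_on (cball 0 r) h"
    by (intro continuous_at_imp_continuous_on ballI) (use der DERIV_isCont in force)
  have holo: "h holomorphic_on ball 0 r"
    unfolding holomorphic_on_def
  proof
    fix t :: complex assume "t \<in> ball 0 r"
    then obtain d where "(h has_field_derivative d) (at t)" using der[of t] by auto
    then show "h field_differentiable at t within ball 0 r"
      using has_field_derivative_at_within field_differentiable_def by blast
  qed
  have wp: "w x \<noteq> 0" for x using r by (simp add: w_def)
  have "(h has_field_derivative (1 / (2 * of_real pi * \<i>) *
          contour_integral (circlepath 0 r) (\<lambda>u. h u / (u - 0)^2))) (at 0)"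
    by (rule Cauchy_derivative_integral_circlepath) (use cont holo r in auto)
  moreover have "pderiv_at i f z = deriv h 0"
    by (simp add: pderiv_at_def h_def axis_smult[of i, symmetric])
  ultimately have "pderiv_at i f z = 1 / (2 * of_real pi * \<i>) *
          contour_integral (circlepath 0 r) (\<lambda>u. h u / (u - 0)^2)"
    by (simp add: DERIV_imp_deriv)
  also have "contour_integral (circlepath 0 r) (\<lambda>u. h u / (u - 0)^2) =
     integral {0..1} (\<lambda>x. h (w x) / (w x)^2 * (2 * of_real pi * \<i> * w x))"
    unfolding contour_integral_integral vector_derivative_circlepath
    by (simp add: circlepath w_def mult.assoc)
  also have "\<dots> = integral {0..1} (\<lambda>x. 2 * of_real pi * \<i> * (h (w x) / w x))"
    by (rule integral_cong) (use wp in \<open>simp add: power2_eq_square field_simps\<close>)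
  also have "\<dots> = 2 * of_real pi * \<i> * integral {0..1} (\<lambda>x. h (w x) / w x)"
    unfolding times_divide_eq_right[symmetric] by (rule integral_mult_right)
  finally show ?thesis
    by (simp add: h_def axis_smult[of i, symmetric])
qed

lemma pderiv_at_continuous:
  fixes f :: "complex ^ 'n::finite \<Rightarrow> complex"
  assumes f: "\<And>z. z \<in> ball 0 R \<Longrightarrow> complex_differentiable_at f z"
    and r: "0 < r" "2 * r < R"
  shows "continuous_on (ball 0 r) (pderiv_at i f)"
proof -
  define w where "w = (\<lambda>x::real. of_real r * exp (2 * of_real pi * \<i> * of_real x))"
  have wp: "w x \<noteq> 0" "norm (w x) = r" for x using r by (simp_all add: w_def norm_mult)
  have wc: "continuous_on A w" for A unfolding w_def by (intro continuous_intros)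
  have fc: "continuous_on (ball 0 R) f"
    by (intro continuous_at_imp_continuous_on ballI)
       (use f complex_differentiable_at_def has_derivative_continuous in blast)
  have "z + axis i (w x) \<in> ball 0 R" if "z \<in> ball 0 r" for z :: "complex ^ 'n" and x
    using norm_triangle_ineq[of z "axis i (w x)"] that r wp(2)[of x] by (simp add: norm_axis_complex)
  then have "continuous_on (ball 0 r \<times> cbox 0 1) (\<lambda>(z, x). f (z + axis i (w x)) / w x)"
    unfolding split_beta
    by (intro continuous_intros continuous_on_compose2[OF fc] continuous_on_compose2[OF wc]
          bounded_linear.continuous_on[OF bounded_linear_axis]) (use wp in auto)
  then have "continuous_on (ball 0 r) (\<lambda>z. integral (cbox 0 1) (\<lambda>x. f (z + axis i (w x)) / w x))"
    by (rule integral_continuous_on_param)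
  moreover have "pderiv_at i f z = integral (cbox 0 1) (\<lambda>x. f (z + axis i (w x)) / w x)"
    if "z \<in> ball 0 r" for z
    using pderiv_at_integral[OF f r that, of i] by (simp add: w_def)
  ultimately show ?thesis
    by (rule continuous_on_eq[OF _ sym])
qed

lemma pderiv_at_cdiff_aux:
  fixes f :: "complex ^ 'n::finite \<Rightarrow> complex"
  assumes f: "\<And>z. z \<in> ball 0 R \<Longrightarrow> complex_differentiable_at f z"
    and r: "0 < r" "6 * r < R" and z0: "z0 \<in> ball 0 r"
  defines "w \<equiv> \<lambda>x. of_real r * exp (2 * of_real pi * \<i> * of_real x)"
  shows "(pderiv_at j f has_derivative
     (\<lambda>v. \<Sum>i\<in>UNIV. v $ i * integral (cbox 0 1) (\<lambda>x. pderiv_at i f (z0 + axis j (w x)) / w x))) (at z0)"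
proof -
  have wp: "w x \<noteq> 0" "norm (w x) = r" for x using r by (simp_all add: w_def norm_mult)
  have wc: "continuous_on A w" for A unfolding w_def by (intro continuous_intros)
  have inb: "z + axis j (w x) \<in> ball 0 (2 * r + r / 2)" "z + axis j (w x) \<in> ball 0 R"
    if "z \<in> ball 0 r" for z :: "complex ^ 'n" and x
    using norm_triangle_ineq[of z "axis j (w x)"] that r wp(2)[of x] by (simp_all add: norm_axis_complex)
  define M where "M = (\<lambda>z x. \<lambda>v. (\<Sum>i\<in>UNIV. v $ i * pderiv_at i f (z + axis j (w x))) / w x)"
  have bl: "bounded_linear (M z x)" for z x
    unfolding M_def
    unfolding linear_conv_bounded_linear[symmetric]
    by (rule linearI)
       (simp_all add: distrib_right sum.distrib add_divide_distrib divide_inverse flip: scaleR_sum_right)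
  define fx where "fx = (\<lambda>z x. Blinfun (M z x))"
  have fx: "blinfun_apply (fx z x) = M z x" for z x
    by (simp add: fx_def bounded_linear_Blinfun_apply bl)
  have pc: "continuous_on (ball 0 (2 * r + r / 2)) (pderiv_at i f)" for i
    by (rule pderiv_at_continuous[of R]) (use f r in auto)
  have pc2: "continuous_on (ball 0 r \<times> cbox 0 1) (\<lambda>y. pderiv_at i f (fst y + axis j (w (snd y))))" for i
    by (intro continuous_intros continuous_on_compose2[OF pc] continuous_on_compose2[OF wc]
          bounded_linear.continuous_on[OF bounded_linear_axis]) (use inb in auto)
  have pc3: "continuous_on (ball 0 r \<times> cbox 0 1) (\<lambda>y. w (snd y))"
    by (rule continuous_on_compose2[OF wc[of UNIV] continuous_on_snd[OF continuous_on_id]]) simp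
  have cfx: "continuous_on (ball 0 r \<times> cbox 0 1) (\<lambda>(z, x). fx z x)"
    unfolding split_beta
    by (intro continuous_on_blinfun_componentwise, unfold fx M_def, intro continuous_intros pc2 pc3)
       (use wp in auto)
  have fc: "continuous_on (ball 0 R) f"
    by (intro continuous_at_imp_continuous_on ballI)
       (use f complex_differentiable_at_def has_derivative_continuous in blast)
  have "((\<lambda>z. integral (cbox 0 1) (\<lambda>x. f (z + axis j (w x)) / w x)) has_derivative
           blinfun_apply (integral (cbox 0 1) (fx z0))) (at z0 within ball 0 r)"
  proof (rule leibniz_rule[OF _ _ cfx z0])
    fix z :: "complex ^ 'n" and x :: real assume z: "z \<in> ball 0 r"
    have "(f has_derivative (\<lambda>v. \<Sum>i\<in>UNIV. v $ i * pderiv_at i f (z + axis j (w x))))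
            (at (z + axis j (w x)))"
      by (rule cdiff_has_derivative[OF f[OF inb(2)[OF z]]])
    then have "((\<lambda>z. f (z + axis j (w x))) has_derivative
        (\<lambda>v. \<Sum>i\<in>UNIV. v $ i * pderiv_at i f (z + axis j (w x)))) (at z)"
      by (rule has_derivative_compose[rotated])
         (rule has_derivative_add_const[OF has_derivative_ident])
    then have "((\<lambda>z. f (z + axis j (w x)) * inverse (w x)) has_derivative
        (\<lambda>v. (\<Sum>i\<in>UNIV. v $ i * pderiv_at i f (z + axis j (w x))) * inverse (w x))) (at z)"
      by (rule has_derivative_mult_left)
    then show "((\<lambda>z. f (z + axis j (w x)) / w x) has_derivative blinfun_apply (fx z x)) (at z within ball 0 r)"
      unfolding fx M_def divide_inverse by (rule has_derivative_at_withinI)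
  next
    fix z :: "complex ^ 'n" assume z: "z \<in> ball 0 r"
    show "(\<lambda>x. f (z + axis j (w x)) / w x) integrable_on cbox 0 1"
      by (intro integrable_continuous continuous_intros wc continuous_on_compose2[OF fc]
            bounded_linear.continuous_on[OF bounded_linear_axis])
         (use wp inb(2)[OF z] in auto)
  qed auto
  then have "((\<lambda>z. integral (cbox 0 1) (\<lambda>x. f (z + axis j (w x)) / w x)) has_derivative
           blinfun_apply (integral (cbox 0 1) (fx z0))) (at z0)"
    using z0 at_within_open[of z0 "ball 0 r"] by simp
  then have "(pderiv_at j f has_derivative blinfun_apply (integral (cbox 0 1) (fx z0))) (at z0)"
  proof (rule has_derivative_transform_within_open)
    show "integral (cbox 0 1) (\<lambda>x. f (z + axis j (w x)) / w x) = pderiv_at j f z"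
      if "z \<in> ball 0 r" for z
      unfolding w_def by (rule pderiv_at_integral[symmetric, of R]) (use f r that in simp_all)
  qed (use z0 in auto)
  moreover have "blinfun_apply (integral (cbox 0 1) (fx z0)) v =
     (\<Sum>i\<in>UNIV. v $ i * integral (cbox 0 1) (\<lambda>x. pderiv_at i f (z0 + axis j (w x)) / w x))" for v
  proof -
    have c: "continuous_on (cbox 0 1) (\<lambda>x. pderiv_at i f (z0 + axis j (w x)) / w x)" for i
      by (intro continuous_intros continuous_on_compose2[OF pc] wc
            bounded_linear.continuous_on[OF bounded_linear_axis]) (use inb[OF z0] wp in auto)
    have "continuous_on (cbox 0 1) (\<lambda>x. fx z0 x)"
      using continuous_on_compose2[OF cfx, of "cbox 0 1" "\<lambda>x. (z0, x)",
          OF continuous_on_Pair[OF continuous_on_const continuous_on_id]] z0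
      by (auto simp: image_subset_iff)
    then have fi: "fx z0 integrable_on cbox 0 1" by (rule integrable_continuous)
    have "blinfun_apply (integral (cbox 0 1) (fx z0)) v = integral (cbox 0 1) (\<lambda>x. M z0 x v)"
      unfolding blinfun_apply_integral[OF fi] fx ..
    also have "(\<lambda>x. M z0 x v) = (\<lambda>x. \<Sum>i\<in>UNIV. v $ i * (pderiv_at i f (z0 + axis j (w x)) / w x))"
      by (simp add: M_def sum_divide_distrib)
    also have "integral (cbox 0 1) \<dots> =
       (\<Sum>i\<in>UNIV. integral (cbox 0 1) (\<lambda>x. v $ i * (pderiv_at i f (z0 + axis j (w x)) / w x)))"
      by (rule integral_sum, simp, rule integrable_continuous, rule continuous_on_mult_left[OF c])
    finally show ?thesis by (simp only: integral_mult_right)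
  qed
  then have "blinfun_apply (integral (cbox 0 1) (fx z0)) =
     (\<lambda>v. \<Sum>i\<in>UNIV. v $ i * integral (cbox 0 1) (\<lambda>x. pderiv_at i f (z0 + axis j (w x)) / w x))"
    by blast
  ultimately show ?thesis by (simp only:)
qed

lemma pderiv_at_cdiff:
  fixes f :: "complex ^ 'n::finite \<Rightarrow> complex"
  assumes f: "\<And>z. z \<in> ball 0 R \<Longrightarrow> complex_differentiable_at f z"
    and r: "0 < r" "6 * r < R" and z: "z \<in> ball 0 r"
  shows "complex_differentiable_at (pderiv_at j f) z"
  unfolding complex_differentiable_at_def
proof (intro exI conjI allI)
  show "(pderiv_at j f has_derivative
     (\<lambda>v. \<Sum>i\<in>UNIV. v $ i * integral (cbox 0 1) (\<lambda>x. pderiv_at i f (z + axis j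
        (of_real r * exp (2 * of_real pi * \<i> * of_real x))) /
        (of_real r * exp (2 * of_real pi * \<i> * of_real x))))) (at z)"
    by (rule pderiv_at_cdiff_aux[OF f r z])
qed (simp only: vector_smult_component sum_distrib_left mult.assoc)

lemma pderiv_at_commute:
  fixes f :: "complex ^ 'n::finite \<Rightarrow> complex"
  assumes f: "\<And>z. z \<in> ball 0 R \<Longrightarrow> complex_differentiable_at f z"
    and r: "0 < r" "12 * r < R" and z: "z \<in> ball 0 (r / 3)"
  shows "pderiv_at i (pderiv_at j f) z = pderiv_at j (pderiv_at i f) z"
proof -
  define w where "w = (\<lambda>x::real. of_real (r/3) * exp (2 * of_real pi * \<i> * of_real x))"
  define S where "S = (\<lambda>i. integral (cbox 0 1) (\<lambda>x. pderiv_at i f (z + axis j (w x)) / w x))"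
  have "(pderiv_at j f has_derivative (\<lambda>v. \<Sum>k\<in>UNIV. v $ k * S k)) (at z)"
    unfolding S_def w_def by (rule pderiv_at_cdiff_aux[of R]) (use f r z in auto)
  then have "pderiv_at i (pderiv_at j f) z = (\<Sum>k\<in>UNIV. (axis i 1 :: complex ^ 'n) $ k * S k)"
    by (rule pderiv_at_eq) (simp only: vector_smult_component sum_distrib_left mult.assoc)
  also have "\<dots> = S i"
  proof -
    have "(\<lambda>k. (axis i 1 :: complex ^ 'n) $ k * S k) = (\<lambda>k. if i = k then S k else 0)"
      by (auto simp: axis_def)
    then show ?thesis by (simp only: sum.delta sum.delta' finite_class.finite_UNIV UNIV_I if_True)
  qed
  also have "\<dots> = pderiv_at j (pderiv_at i f) z"
    unfolding S_def w_def
  proof (rule pderiv_at_integral[symmetric])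
    fix y :: "complex ^ 'n" assume y: "y \<in> ball 0 r"
    show "complex_differentiable_at (pderiv_at i f) y"
      by (rule pderiv_at_cdiff[of R f r]) (use f r y in auto)
  qed (use z r in auto)
  finally show ?thesis .
qed


section \<open>The ring of germs\<close>

lemma holomorphic_near0_ball:
  "holomorphic_near0 f \<longleftrightarrow> (\<exists>R>0. \<forall>z\<in>ball 0 R. complex_differentiable_at f z)"
  unfolding holomorphic_near0_def eventually_nhds_metric by (auto simp: dist_commute)

definition germ_rel :: "(complex ^ 'n::finite \<Rightarrow> complex) \<Rightarrow> (complex ^ 'n \<Rightarrow> complex) \<Rightarrow> bool" where
  "germ_rel f g \<longleftrightarrow> holomorphic_near0 f \<and> holomorphic_near0 g \<and> (\<forall>\<^sub>F z in nhds 0. f z = g z)"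

lemma holomorphic_near0_const: "holomorphic_near0 (\<lambda>_. c)"
  by (simp add: holomorphic_near0_def cdiff_const)

lemma holomorphic_near0_add:
  "holomorphic_near0 f \<Longrightarrow> holomorphic_near0 g \<Longrightarrow> holomorphic_near0 (\<lambda>z. f z + g z)"
  unfolding holomorphic_near0_def by (erule (1) eventually_elim2) (rule cdiff_add)

lemma holomorphic_near0_mult:
  "holomorphic_near0 f \<Longrightarrow> holomorphic_near0 g \<Longrightarrow> holomorphic_near0 (\<lambda>z. f z * g z)"
  unfolding holomorphic_near0_def by (erule (1) eventually_elim2) (rule cdiff_mult)

lemma holomorphic_near0_minus: "holomorphic_near0 f \<Longrightarrow> holomorphic_near0 (\<lambda>z. - f z)"
  unfolding holomorphic_near0_def by (erule eventually_mono) (rule cdiff_minus)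

lemma holomorphic_near0_pderiv:
  assumes "holomorphic_near0 f"
  shows "holomorphic_near0 (pderiv_at i f)"
proof -
  obtain R where R: "R > 0" "\<And>z. z \<in> ball 0 R \<Longrightarrow> complex_differentiable_at f z"
    using assms unfolding holomorphic_near0_ball by blast
  show ?thesis unfolding holomorphic_near0_ball
  proof (intro exI conjI ballI)
    fix z :: "complex ^ 'a" assume z: "z \<in> ball 0 (R / 7)"
    show "complex_differentiable_at (pderiv_at i f) z"
      by (rule pderiv_at_cdiff[of R f "R / 7"]) (use R z in simp_all)
  qed (use R in simp)
qed

lemma pderiv_at_cong:
  assumes "\<forall>\<^sub>F y in nhds z. f y = g y"
  shows "pderiv_at i f z = pderiv_at i g z"
  unfolding pderiv_at_def
proof (rule deriv_cong_ev)
  have "isCont (\<lambda>t. z + axis i t) 0"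
    by (intro continuous_intros linear_continuous_at[OF bounded_linear_axis])
  then have "((\<lambda>t. z + axis i t) \<longlongrightarrow> z) (nhds 0)"
    using tendsto_at_iff_tendsto_nhds[of "\<lambda>t. z + axis i t" 0] by (simp add: isCont_def axis_smult[of i 0])
  then show "\<forall>\<^sub>F t in nhds 0. f (z + axis i t) = g (z + axis i t)"
    using assms by (rule eventually_compose_filterlim[rotated])
qed simp

lemma pderiv_at_cong_near0:
  assumes "\<forall>\<^sub>F y in nhds 0. f y = g y"
  shows "\<forall>\<^sub>F z in nhds 0. pderiv_at i f z = pderiv_at i g z"
proof -
  have "\<forall>\<^sub>F z in nhds 0. \<forall>\<^sub>F y in nhds z. f y = g y"
    using assms by (simp add: eventually_eventually)
  then show ?thesis by (rule eventually_mono) (rule pderiv_at_cong)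
qed

lemma part_equivp_germ_rel: "part_equivp germ_rel"
proof (rule part_equivpI)
  show "\<exists>f. germ_rel f f"
    by (rule exI[of _ "\<lambda>_. 0"]) (simp add: germ_rel_def holomorphic_near0_const)
  show "symp germ_rel" by (rule sympI) (auto simp: germ_rel_def eq_commute)
  show "transp germ_rel"
    by (rule transpI) (auto simp: germ_rel_def elim: eventually_elim2)
qed

quotient_type (overloaded) 'n hol_germ = "complex ^ ('n::finite) \<Rightarrow> complex" / partial: germ_rel
  by (rule part_equivp_germ_rel)

instantiation hol_germ :: (finite) comm_ring_1
begin

lift_definition zero_hol_germ :: "'a hol_germ" is "\<lambda>_. 0"
  by (simp add: germ_rel_def holomorphic_near0_const)

lift_definition one_hol_germ :: "'a hol_germ" is "\<lambda>_. 1"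
  by (simp add: germ_rel_def holomorphic_near0_const)

lift_definition plus_hol_germ :: "'a hol_germ \<Rightarrow> 'a hol_germ \<Rightarrow> 'a hol_germ"
  is "\<lambda>f g z. f z + g z"
  unfolding germ_rel_def by (auto intro: holomorphic_near0_add elim: eventually_elim2)

lift_definition uminus_hol_germ :: "'a hol_germ \<Rightarrow> 'a hol_germ" is "\<lambda>f z. - f z"
  unfolding germ_rel_def by (auto intro: holomorphic_near0_minus elim: eventually_mono)

lift_definition times_hol_germ :: "'a hol_germ \<Rightarrow> 'a hol_germ \<Rightarrow> 'a hol_germ"
  is "\<lambda>f g z. f z * g z"
  unfolding germ_rel_def by (auto intro: holomorphic_near0_mult elim: eventually_elim2)

definition minus_hol_germ :: "'a hol_germ \<Rightarrow> 'a hol_germ \<Rightarrow> 'a hol_germ" where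
  "minus_hol_germ a b = a + - b"

instance
proof
  fix a b c :: "'a hol_germ"
  note rules = holomorphic_near0_add holomorphic_near0_mult holomorphic_near0_minus holomorphic_near0_const
  show "a * b * c = a * (b * c)" by transfer (auto simp: germ_rel_def mult.assoc intro!: rules)
  show "a * b = b * a" by transfer (auto simp: germ_rel_def mult.commute intro!: rules)
  show "1 * a = a" by transfer (auto simp: germ_rel_def)
  show "a + b + c = a + (b + c)" by transfer (auto simp: germ_rel_def add.assoc intro!: rules)
  show "a + b = b + a" by transfer (auto simp: germ_rel_def add.commute intro!: rules)
  show "0 + a = a" by transfer (auto simp: germ_rel_def)
  show "- a + a = 0" by transfer (auto simp: germ_rel_def intro!: rules)
  show "a - b = a + - b" by (simp add: minus_hol_germ_def)
  show "(a + b) * c = a * c + b * c"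
    by transfer (auto simp: germ_rel_def distrib_right intro!: rules)
  show "(0 :: 'a hol_germ) \<noteq> 1"
    by transfer (auto simp: germ_rel_def dest: eventually_nhds_x_imp_x)
qed

end

lemma cdiff_imp_zero_or_zero:
  fixes f g :: "complex ^ 'n::finite \<Rightarrow> complex"
  assumes f: "\<And>z. z \<in> ball 0 R \<Longrightarrow> complex_differentiable_at f z"
    and g: "\<And>z. z \<in> ball 0 R \<Longrightarrow> complex_differentiable_at g z"
    and fg: "\<And>z. z \<in> ball 0 R \<Longrightarrow> f z * g z = 0"
    and a: "a \<in> ball 0 R" "f a \<noteq> 0" and b: "b \<in> ball 0 R"
  shows "g b = 0"
proof -
  define l where "l = (\<lambda>t::complex. a + t *s (b - a))"
  define S where "S = l -` ball 0 R"
  have lin: "bounded_linear (\<lambda>t::complex. t *s (b - a))"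
    unfolding linear_conv_bounded_linear[symmetric]
    by (rule linearI) (auto simp: vec_eq_iff algebra_simps)
  have cl: "continuous_on UNIV l"
    unfolding l_def by (intro continuous_intros bounded_linear.continuous_on[OF lin])
  have S: "open S" unfolding S_def by (rule open_vimage[OF open_ball cl])
  have "S = (\<lambda>t. t *s (b - a)) -` ball (- a) R"
  proof -
    have "dist 0 (a + v) = dist (- a) v" for v :: "complex ^ 'n"
      by (simp add: dist_norm norm_minus_commute[of "- a"] add.commute)
    then show ?thesis by (auto simp: S_def l_def)
  qed
  then have "convex S"
    using convex_linear_vimage[OF bounded_linear.linear[OF lin] convex_ball] by simp
  then have conn: "connected S" by (rule convex_connected)
  have S01: "0 \<in> S" "1 \<in> S" using a b by (auto simp: S_def l_def vec_eq_iff)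
  have holo: "(\<lambda>t. h (l t)) holomorphic_on S"
    if h: "\<And>z. z \<in> ball 0 R \<Longrightarrow> complex_differentiable_at h z" for h
    unfolding holomorphic_on_def
  proof
    fix t assume "t \<in> S"
    then have "complex_differentiable_at h (l t)" using h by (auto simp: S_def)
    then obtain L where "(h has_derivative L) (at (l t))" "\<And>c v. L (c *s v) = c * L v"
      unfolding complex_differentiable_at_def by blast
    then have "((\<lambda>t. h (l t)) has_field_derivative L (b - a)) (at t)"
      unfolding l_def by (intro cdiff_line)
    then show "(\<lambda>t. h (l t)) field_differentiable at t within S"
      using field_differentiable_def has_field_derivative_at_within by blast
  qed
  have cf: "continuous_on S (\<lambda>t. f (l t))"
    by (rule holomorphic_on_imp_continuous_on[OF holo[OF f]])
  define U where "U = S \<inter> (\<lambda>t. f (l t)) -` (- {0})"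
  have "open U" unfolding U_def
    by (rule continuous_open_preimage[OF cf S]) auto
  moreover have "0 \<in> U" using S01 a by (auto simp: U_def l_def)
  moreover have "g (l t) = 0" if "t \<in> U" for t using fg[of "l t"] that by (auto simp: U_def S_def)
  ultimately have "g (l 1) = 0"
    using analytic_continuation_open[of U S "\<lambda>t. g (l t)" "\<lambda>_. 0" 1] S conn S01 holo[OF g]
    by (auto simp: U_def)
  then show ?thesis by (simp add: l_def)
qed

instance hol_germ :: (finite) idom
proof
  fix a b :: "'a hol_germ"
  show "a \<noteq> 0 \<Longrightarrow> b \<noteq> 0 \<Longrightarrow> a * b \<noteq> 0"
  proof transfer
    fix f g :: "complex ^ 'a \<Rightarrow> complex"
    assume f: "germ_rel f f" and g: "germ_rel g g"
      and f0: "\<not> germ_rel f (\<lambda>_. 0)" and g0: "\<not> germ_rel g (\<lambda>_. 0)"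
    show "\<not> germ_rel (\<lambda>z. f z * g z) (\<lambda>_. 0)"
    proof
      assume "germ_rel (\<lambda>z. f z * g z) (\<lambda>_. 0)"
      with f g have "\<forall>\<^sub>F z in nhds 0. complex_differentiable_at f z \<and> complex_differentiable_at g z \<and> f z * g z = 0"
        by (auto simp: germ_rel_def holomorphic_near0_def intro: eventually_conj)
      then obtain R where R: "R > 0" "\<And>z. z \<in> ball 0 R \<Longrightarrow>
          complex_differentiable_at f z \<and> complex_differentiable_at g z \<and> f z * g z = 0"
        unfolding eventually_nhds_metric by (auto simp: dist_commute)
      have ev: "\<forall>\<^sub>F z in nhds 0. z \<in> ball 0 R"
        using R(1) by (intro eventually_nhds_in_open) auto
      have "\<exists>a\<in>ball 0 R. f a \<noteq> 0"
      proof (rule ccontr)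
        assume "\<not> ?thesis"
        then have "\<forall>\<^sub>F z in nhds 0. f z = 0" using ev by (auto elim!: eventually_mono)
        with f f0 show False by (simp add: germ_rel_def holomorphic_near0_const)
      qed
      then obtain a where "a \<in> ball 0 R" "f a \<noteq> 0" by blast
      with R have "g b = 0" if "b \<in> ball 0 R" for b
        using cdiff_imp_zero_or_zero[of R f g a b] that by blast
      then have "\<forall>\<^sub>F z in nhds 0. g z = 0" using ev by (rule eventually_mono[rotated])
      with g g0 show False by (simp add: germ_rel_def holomorphic_near0_const)
    qed
  qed
qed

lift_definition germ_at0 :: "'n::finite hol_germ \<Rightarrow> complex" is "\<lambda>f. f 0"
  by (auto simp: germ_rel_def dest: eventually_nhds_x_imp_x)

lift_definition germ_const :: "complex \<Rightarrow> 'n::finite hol_germ" is "\<lambda>c _. c"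
  by (simp add: germ_rel_def holomorphic_near0_const)

lift_definition germ_deriv :: "'n \<Rightarrow> 'n::finite hol_germ \<Rightarrow> 'n hol_germ" is pderiv_at
  by (auto simp: germ_rel_def intro: holomorphic_near0_pderiv pderiv_at_cong_near0)

lemma pderiv_at_add:
  assumes "complex_differentiable_at f z" "complex_differentiable_at g z"
  shows "pderiv_at i (\<lambda>z. f z + g z) z = pderiv_at i f z + pderiv_at i g z"
proof -
  obtain L M where *: "(f has_derivative L) (at z)" "\<And>c v. L (c *s v) = c * L v"
    "(g has_derivative M) (at z)" "\<And>c v. M (c *s v) = c * M v"
    using assms unfolding complex_differentiable_at_def by blast
  have "((\<lambda>z. f z + g z) has_derivative (\<lambda>v. L v + M v)) (at z)"
    using * by (auto intro!: derivative_eq_intros)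
  from pderiv_at_eq[OF this] pderiv_at_eq[OF *(1,2)] pderiv_at_eq[OF *(3,4)] show ?thesis
    by (simp add: * algebra_simps)
qed

lemma pderiv_at_mult:
  assumes "complex_differentiable_at f z" "complex_differentiable_at g z"
  shows "pderiv_at i (\<lambda>z. f z * g z) z = pderiv_at i f z * g z + f z * pderiv_at i g z"
proof -
  obtain L M where *: "(f has_derivative L) (at z)" "\<And>c v. L (c *s v) = c * L v"
    "(g has_derivative M) (at z)" "\<And>c v. M (c *s v) = c * M v"
    using assms unfolding complex_differentiable_at_def by blast
  have "((\<lambda>z. f z * g z) has_derivative (\<lambda>v. f z * M v + L v * g z)) (at z)"
    using * by (auto intro!: derivative_eq_intros)
  from pderiv_at_eq[OF this] pderiv_at_eq[OF *(1,2)] pderiv_at_eq[OF *(3,4)] show ?thesis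
    by (simp add: * algebra_simps)
qed

lemma germ_deriv_add: "germ_deriv i (a + b) = germ_deriv i a + germ_deriv i b"
  by transfer (auto simp: germ_rel_def holomorphic_near0_def
      intro: holomorphic_near0_pderiv[unfolded holomorphic_near0_def]
        holomorphic_near0_add[unfolded holomorphic_near0_def] pderiv_at_add elim: eventually_elim2)

lemma germ_deriv_mult: "germ_deriv i (a * b) = germ_deriv i a * b + a * germ_deriv i b"
proof transfer
  fix i :: 'a and f g :: "complex ^ 'a \<Rightarrow> complex"
  assume "germ_rel f f" "germ_rel g g"
  then have fg: "holomorphic_near0 f" "holomorphic_near0 g" by (simp_all add: germ_rel_def)
  then have "\<forall>\<^sub>F z in nhds 0. pderiv_at i (\<lambda>z. f z * g z) z = pderiv_at i f z * g z + f z * pderiv_at i g z"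
    unfolding holomorphic_near0_def by (rule eventually_elim2) (rule pderiv_at_mult)
  with fg show "germ_rel (pderiv_at i (\<lambda>z. f z * g z)) (\<lambda>z. pderiv_at i f z * g z + f z * pderiv_at i g z)"
    by (simp add: germ_rel_def holomorphic_near0_pderiv holomorphic_near0_mult holomorphic_near0_add)
qed

lemma germ_deriv_const: "germ_deriv i (germ_const c) = 0"
  by transfer (auto simp: germ_rel_def pderiv_at_def[abs_def] holomorphic_near0_const)

lemma germ_deriv_commute: "germ_deriv i (germ_deriv j a) = germ_deriv j (germ_deriv i a)"
proof transfer
  fix i j :: 'a and f :: "complex ^ 'a \<Rightarrow> complex"
  assume "germ_rel f f"
  then have f: "holomorphic_near0 f" by (simp add: germ_rel_def)
  then obtain R where R: "R > 0" "\<And>z. z \<in> ball 0 R \<Longrightarrow> complex_differentiable_at f z"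
    unfolding holomorphic_near0_ball by blast
  have "\<forall>\<^sub>F z in nhds 0. z \<in> ball 0 ((R / 13) / 3)"
    using R(1) by (intro eventually_nhds_in_open) auto
  then have "\<forall>\<^sub>F z in nhds 0. pderiv_at i (pderiv_at j f) z = pderiv_at j (pderiv_at i f) z"
    by (rule eventually_mono) (rule pderiv_at_commute[of R f "R / 13"]; use R in simp)
  then show "germ_rel (pderiv_at i (pderiv_at j f)) (pderiv_at j (pderiv_at i f))"
    by (simp add: germ_rel_def f holomorphic_near0_pderiv)
qed

section \<open>Germs of meromorphic functions\<close>

type_synonym 'n mero_germ = "'n hol_germ fract"

definition of_germ :: "'n::finite hol_germ \<Rightarrow> 'n mero_germ" where
  "of_germ g = Fract g 1"

text \<open>
  Germs of meromorphic functions form the fraction field of the ring of germs of holomorphic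
  functions. The derivation is the quotient rule on a chosen representative; lemma
  \<open>mero_deriv_Fract\<close> shows that the representative does not matter.
\<close>

definition mero_deriv :: "'n \<Rightarrow> 'n::finite mero_germ \<Rightarrow> 'n mero_germ" where
  "mero_deriv i u = (let (g, h) = (SOME (g, h). h \<noteq> 0 \<and> u = Fract g h)
     in Fract (germ_deriv i g * h - g * germ_deriv i h) (h * h))"

lemma mero_deriv_Fract:
  assumes "h \<noteq> 0"
  shows "mero_deriv i (Fract g h) = Fract (germ_deriv i g * h - g * germ_deriv i h) (h * h)"
proof -
  define p where "p = (SOME (a, b). b \<noteq> 0 \<and> Fract g h = Fract a b)"
  obtain a b where p: "p = (a, b)" by (cases p)
  have "case p of (a, b) \<Rightarrow> b \<noteq> 0 \<and> Fract g h = Fract a b"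
    unfolding p_def by (rule someI[of _ "(g, h)"]) (use assms in simp)
  then have nz: "b \<noteq> 0" and eq: "a * h = g * b"
    using assms eq_fract(1)[of h b g a] by (simp_all add: p)
  from arg_cong[OF eq, of "germ_deriv i"]
  have deq: "germ_deriv i a * h = germ_deriv i g * b + g * germ_deriv i b - a * germ_deriv i h"
    by (simp add: germ_deriv_mult algebra_simps)
  have "(germ_deriv i a * b - a * germ_deriv i b) * (h * h)
      = (germ_deriv i a * h) * (b * h) - (a * h) * h * germ_deriv i b"
    by (simp add: algebra_simps)
  also have "\<dots> = (germ_deriv i g * h - g * germ_deriv i h) * (b * b)
      + (g * b - a * h) * (h * germ_deriv i b + b * germ_deriv i h)"
    unfolding deq by (simp add: algebra_simps)
  also have "\<dots> = (germ_deriv i g * h - g * germ_deriv i h) * (b * b)"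
    by (simp add: eq)
  finally show ?thesis
    using nz assms by (simp add: mero_deriv_def p_def[symmetric] p eq_fract)
qed

lemma germ_deriv_0 [simp]: "germ_deriv i 0 = 0"
  using germ_deriv_add[of i 0 0] by (metis add_cancel_right_right add_0_left)

lemma germ_deriv_1 [simp]: "germ_deriv i 1 = 0"
  using germ_deriv_mult[of i 1 1] by (metis add_cancel_right_right mult_1_left mult_1_right)

lemma of_germ_0 [simp]: "of_germ 0 = 0" by (simp add: of_germ_def Zero_fract_def)
lemma of_germ_1 [simp]: "of_germ 1 = 1" by (simp add: of_germ_def One_fract_def)
lemma of_germ_add: "of_germ (a + b) = of_germ a + of_germ b" by (simp add: of_germ_def)
lemma of_germ_mult: "of_germ (a * b) = of_germ a * of_germ b" by (simp add: of_germ_def)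
lemma of_germ_minus: "of_germ (- a) = - of_germ a" by (simp add: of_germ_def)
lemma of_germ_eq_iff: "of_germ a = of_germ b \<longleftrightarrow> a = b" by (simp add: of_germ_def eq_fract)
lemma of_germ_eq_0_iff: "of_germ a = 0 \<longleftrightarrow> a = 0" using of_germ_eq_iff[of a 0] by simp

lemma mero_deriv_of_germ: "mero_deriv i (of_germ g) = of_germ (germ_deriv i g)"
  by (simp add: of_germ_def mero_deriv_Fract)

lemma mero_deriv_add: "mero_deriv i (x + y) = mero_deriv i x + mero_deriv i y"
proof (cases x; cases y)
  fix a b c d :: "'a hol_germ"
  assume "x = Fract a b" "b \<noteq> 0" "y = Fract c d" "d \<noteq> 0"
  then show ?thesis
    by (simp add: mero_deriv_Fract eq_fract) (simp add: germ_deriv_add germ_deriv_mult algebra_simps)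
qed

lemma mero_deriv_mult: "mero_deriv i (x * y) = mero_deriv i x * y + x * mero_deriv i y"
proof (cases x; cases y)
  fix a b c d :: "'a hol_germ"
  assume "x = Fract a b" "b \<noteq> 0" "y = Fract c d" "d \<noteq> 0"
  then show ?thesis
    by (simp add: mero_deriv_Fract eq_fract) (simp add: germ_deriv_add germ_deriv_mult algebra_simps)
qed

lemma mero_deriv_0 [simp]: "mero_deriv i 0 = 0"
  using mero_deriv_add[of i 0 0] by (metis add_cancel_right_right add_0_left)

lemma mero_deriv_commute: "mero_deriv i (mero_deriv j x) = mero_deriv j (mero_deriv i x)"
proof (cases x)
  fix a b :: "'a hol_germ"
  assume x: "x = Fract a b" "b \<noteq> 0"
  have "x * of_germ b = of_germ a" using x by (simp add: of_germ_def eq_fract)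
  have com: "mero_deriv i (mero_deriv j (of_germ g)) = mero_deriv j (mero_deriv i (of_germ g))" for g :: "'a hol_germ"
    by (simp add: mero_deriv_of_germ germ_deriv_commute)
  have "mero_deriv i (mero_deriv j (x * of_germ b)) = mero_deriv j (mero_deriv i (x * of_germ b))"
    using com \<open>x * of_germ b = of_germ a\<close> by simp
  then have "(mero_deriv i (mero_deriv j x) - mero_deriv j (mero_deriv i x)) * of_germ b = 0"
    by (simp add: mero_deriv_mult mero_deriv_add com algebra_simps)
  then show ?thesis using x by (simp add: of_germ_eq_0_iff)
qed

section \<open>Differential operators\<close>

text \<open>
  The iterated derivative with multi-index \<open>\<alpha>\<close>. The fold is independent of the order of the
  coordinates because the derivations to which it is applied commute (\<open>mero_deriv_commute\<close> and
  \<open>twisted_deriv_commute\<close> below).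
\<close>

definition deriv_power :: "('n::finite \<Rightarrow> 'a \<Rightarrow> 'a) \<Rightarrow> ('n \<Rightarrow> nat) \<Rightarrow> 'a \<Rightarrow> 'a" where
  "deriv_power \<delta> \<alpha> = Finite_Set.fold (\<lambda>i P. (\<delta> i ^^ \<alpha> i) \<circ> P) id UNIV"

definition diff_sum ::
  "('n::finite \<Rightarrow> 'a \<Rightarrow> 'a) \<Rightarrow> ('n \<Rightarrow> nat) set \<Rightarrow> (('n \<Rightarrow> nat) \<Rightarrow> 'a) \<Rightarrow> 'a \<Rightarrow> 'a::comm_ring_1" where
  "diff_sum \<delta> A a u = (\<Sum>\<alpha>\<in>A. a \<alpha> * deriv_power \<delta> \<alpha> u)"

text \<open>
  The ring of germs of differential operators is realised by its faithful action on germs of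
  meromorphic functions, so that the product is composition and the action on meromorphic germs is
  application. An operator determines its coefficients: see \<open>diff_op_coeffs_unique\<close>.
\<close>

definition diff_ops :: "('n::finite mero_germ \<Rightarrow> 'n mero_germ) set" where
  "diff_ops = {diff_sum mero_deriv A (\<lambda>\<alpha>. of_germ (a \<alpha>)) | A a. finite A}"

definition diff_op_ring :: "('n::finite mero_germ \<Rightarrow> 'n mero_germ) ring" where
  "diff_op_ring = \<lparr>carrier = diff_ops, mult = (\<circ>), one = id, zero = (\<lambda>_. 0),
     add = (\<lambda>P Q u. P u + Q u)\<rparr>"

lemma deriv_power_upd:
  assumes comm: "\<And>i j u. \<delta> i (\<delta> j u) = \<delta> j (\<delta> i u)"
  shows "deriv_power \<delta> (\<alpha>(i := Suc (\<alpha> i))) = \<delta> i \<circ> deriv_power \<delta> \<alpha>"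
proof -
  have pw: "(\<delta> i ^^ m) (\<delta> j u) = \<delta> j ((\<delta> i ^^ m) u)" for i j m u
    by (induction m) (simp_all add: comm)
  have pw2: "(\<delta> i ^^ m) ((\<delta> j ^^ k) u) = (\<delta> j ^^ k) ((\<delta> i ^^ m) u)" for i j m k u
    by (induction k) (simp_all add: pw)
  have cfc: "comp_fun_commute_on UNIV (\<lambda>i P. (\<delta> i ^^ \<alpha> i) \<circ> P)" for \<alpha>
    by unfold_locales (auto simp: fun_eq_iff pw2)
  have ins: "deriv_power \<delta> \<alpha> =
      (\<delta> i ^^ \<alpha> i) \<circ> Finite_Set.fold (\<lambda>i P. (\<delta> i ^^ \<alpha> i) \<circ> P) id (UNIV - {i})" for \<alpha>
    unfolding deriv_power_def by (rule comp_fun_commute_on.fold_rec[OF cfc]) auto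
  have "Finite_Set.fold (\<lambda>j P. (\<delta> j ^^ (\<alpha>(i := Suc (\<alpha> i))) j) \<circ> P) id (UNIV - {i})
      = Finite_Set.fold (\<lambda>j P. (\<delta> j ^^ \<alpha> j) \<circ> P) id (UNIV - {i})"
    by (rule fold_closed_eq[where B = UNIV]) auto
  then show ?thesis unfolding ins[of "\<alpha>(i := Suc (\<alpha> i))"] ins[of \<alpha>] by (auto simp: fun_eq_iff)
qed

lemma deriv_power_0:
  fixes \<delta> :: "'n::finite \<Rightarrow> 'b \<Rightarrow> 'b"
  shows "deriv_power \<delta> (\<lambda>_. 0) = id"
proof -
  have cfc: "comp_fun_commute_on UNIV (\<lambda>(i::'n) (P::'b \<Rightarrow> 'b). P)" by unfold_locales auto
  have "Finite_Set.fold (\<lambda>i P. P) id A = (id :: 'b \<Rightarrow> 'b)" if "finite A" for A :: "'n set"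
    using that by induction (simp_all add: comp_fun_commute_on.fold_insert[OF cfc])
  then show ?thesis by (simp add: deriv_power_def)
qed

lemma multi_index_induct [case_names zero step]:
  fixes \<alpha> :: "'n::finite \<Rightarrow> nat"
  assumes "P (\<lambda>_. 0)" "\<And>\<alpha> i. P \<alpha> \<Longrightarrow> P (\<alpha>(i := Suc (\<alpha> i)))"
  shows "P \<alpha>"
proof (induction "\<Sum>i\<in>UNIV. \<alpha> i" arbitrary: \<alpha>)
  case 0
  then have "\<alpha> = (\<lambda>_. 0)" by auto
  then show ?case using assms(1) by simp
next
  case (Suc m)
  then obtain i where i: "\<alpha> i \<noteq> 0" by (metis Zero_not_Suc sum.neutral)
  define \<beta> where "\<beta> = \<alpha>(i := \<alpha> i - 1)"
  have "(\<Sum>j\<in>UNIV. \<alpha> j) = \<alpha> i + (\<Sum>j\<in>UNIV - {i}. \<alpha> j)" by (simp add: sum.remove)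
  moreover have "(\<Sum>j\<in>UNIV. \<beta> j) = \<beta> i + (\<Sum>j\<in>UNIV - {i}. \<alpha> j)"
    by (subst sum.remove[of _ i]) (auto simp: \<beta>_def)
  ultimately have "m = (\<Sum>j\<in>UNIV. \<beta> j)" using Suc(2) i by (simp add: \<beta>_def)
  then have "P (\<beta>(i := Suc (\<beta> i)))" by (intro assms(2) Suc(1))
  moreover have "\<beta>(i := Suc (\<beta> i)) = \<alpha>" using i by (auto simp: \<beta>_def)
  ultimately show ?case by simp
qed

lemma diff_ops_iff:
  "P \<in> diff_ops \<longleftrightarrow> (\<exists>A a. finite A \<and> P = (\<lambda>u. \<Sum>\<alpha>\<in>A. of_germ (a \<alpha>) * deriv_power mero_deriv \<alpha> u))"
  unfolding diff_ops_def diff_sum_def[abs_def] by blast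

lemma diff_ops_monom: "(\<lambda>u. of_germ g * deriv_power mero_deriv \<alpha> u) \<in> diff_ops"
  unfolding diff_ops_iff by (rule exI[of _ "{\<alpha>}"], rule exI[of _ "\<lambda>_. g"]) simp

lemma diff_ops_zero: "(\<lambda>_. 0) \<in> diff_ops"
  unfolding diff_ops_iff by (rule exI[of _ "{}"]) simp

lemma diff_ops_add:
  assumes "P \<in> diff_ops" "Q \<in> diff_ops"
  shows "(\<lambda>u. P u + Q u) \<in> diff_ops"
proof -
  obtain A a B b where *: "finite A" "P = (\<lambda>u. \<Sum>\<alpha>\<in>A. of_germ (a \<alpha>) * deriv_power mero_deriv \<alpha> u)"
     "finite B" "Q = (\<lambda>u. \<Sum>\<alpha>\<in>B. of_germ (b \<alpha>) * deriv_power mero_deriv \<alpha> u)"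
    using assms unfolding diff_ops_iff by blast
  define c where "c = (\<lambda>\<alpha>. (if \<alpha> \<in> A then a \<alpha> else 0) + (if \<alpha> \<in> B then b \<alpha> else 0))"
  have "(\<lambda>u. P u + Q u) = (\<lambda>u. \<Sum>\<alpha>\<in>A \<union> B. of_germ (c \<alpha>) * deriv_power mero_deriv \<alpha> u)"
  proof
    fix u
    have "P u = (\<Sum>\<alpha>\<in>A \<union> B. of_germ (if \<alpha> \<in> A then a \<alpha> else 0) * deriv_power mero_deriv \<alpha> u)"
      unfolding * by (rule sum.mono_neutral_cong_left) (use * in auto)
    moreover have "Q u = (\<Sum>\<alpha>\<in>A \<union> B. of_germ (if \<alpha> \<in> B then b \<alpha> else 0) * deriv_power mero_deriv \<alpha> u)"
      unfolding * by (rule sum.mono_neutral_cong_left) (use * in auto)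
    ultimately show "P u + Q u = (\<Sum>\<alpha>\<in>A \<union> B. of_germ (c \<alpha>) * deriv_power mero_deriv \<alpha> u)"
      by (simp add: c_def of_germ_add distrib_right sum.distrib)
  qed
  then show ?thesis unfolding diff_ops_iff using * by blast
qed

lemma diff_ops_sum:
  "finite A \<Longrightarrow> (\<And>x. x \<in> A \<Longrightarrow> P x \<in> diff_ops) \<Longrightarrow> (\<lambda>u. \<Sum>x\<in>A. P x u) \<in> diff_ops"
  by (induction A rule: finite_induct) (auto intro: diff_ops_zero diff_ops_add)

lemma diff_ops_mult:
  assumes "P \<in> diff_ops"
  shows "(\<lambda>u. of_germ g * P u) \<in> diff_ops"
proof -
  obtain A a where "finite A" "P = (\<lambda>u. \<Sum>\<alpha>\<in>A. of_germ (a \<alpha>) * deriv_power mero_deriv \<alpha> u)"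
    using assms unfolding diff_ops_iff by blast
  then show ?thesis unfolding diff_ops_iff
    by (intro exI[of _ A] exI[of _ "\<lambda>\<alpha>. g * a \<alpha>"]) (simp add: sum_distrib_left of_germ_mult mult.assoc)
qed

lemma mero_deriv_sum: "mero_deriv i (\<Sum>x\<in>A. f x) = (\<Sum>x\<in>A. mero_deriv i (f x))"
  by (induction A rule: infinite_finite_induct) (simp_all add: mero_deriv_add)

lemma diff_ops_deriv:
  assumes "P \<in> diff_ops"
  shows "(\<lambda>u. mero_deriv i (P u)) \<in> diff_ops"
proof -
  obtain A a where A: "finite A" "P = (\<lambda>u. \<Sum>\<alpha>\<in>A. of_germ (a \<alpha>) * deriv_power mero_deriv \<alpha> u)"
    using assms unfolding diff_ops_iff by blast
  have "(\<lambda>u. mero_deriv i (P u)) = (\<lambda>u. \<Sum>\<alpha>\<in>A. of_germ (germ_deriv i (a \<alpha>)) * deriv_power mero_deriv \<alpha> u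
      + of_germ (a \<alpha>) * deriv_power mero_deriv (\<alpha>(i := Suc (\<alpha> i))) u)"
    unfolding A(2) mero_deriv_sum mero_deriv_mult mero_deriv_of_germ
      deriv_power_upd[of mero_deriv, OF mero_deriv_commute] by simp
  also have "\<dots> \<in> diff_ops" by (intro diff_ops_sum A diff_ops_add diff_ops_monom)
  finally show ?thesis .
qed

lemma diff_ops_comp:
  assumes "P \<in> diff_ops" "Q \<in> diff_ops"
  shows "P \<circ> Q \<in> diff_ops"
proof -
  have pow: "(\<lambda>u. deriv_power mero_deriv \<alpha> (Q u)) \<in> diff_ops" for \<alpha>
  proof (induction \<alpha> rule: multi_index_induct)
    case zero
    then show ?case using assms(2) by (simp add: deriv_power_0)
  next
    case (step \<alpha> i)
    show ?case
      unfolding deriv_power_upd[of mero_deriv, OF mero_deriv_commute] comp_apply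
      by (rule diff_ops_deriv[OF step])
  qed
  obtain A a where A: "finite A" "P = (\<lambda>u. \<Sum>\<alpha>\<in>A. of_germ (a \<alpha>) * deriv_power mero_deriv \<alpha> u)"
    using assms unfolding diff_ops_iff by blast
  show ?thesis unfolding A(2) comp_def by (intro diff_ops_sum A diff_ops_mult pow)
qed

lemma diff_ops_mult_op: "(\<lambda>u. of_germ g * u) \<in> diff_ops"
  using diff_ops_monom[of g "\<lambda>_. 0"] by (simp add: deriv_power_0)

lemma diff_ops_id: "id \<in> diff_ops"
  using diff_ops_mult_op[of 1] by (simp add: id_def)

lemma diff_ops_mero_deriv: "mero_deriv i \<in> diff_ops"
  using diff_ops_deriv[OF diff_ops_id, of i] by simp

lemma diff_ops_apply_add: "P \<in> diff_ops \<Longrightarrow> P (u + v) = P u + P v"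
proof -
  assume "P \<in> diff_ops"
  then obtain A a where A: "finite A" "P = (\<lambda>u. \<Sum>\<alpha>\<in>A. of_germ (a \<alpha>) * deriv_power mero_deriv \<alpha> u)"
    unfolding diff_ops_iff by blast
  have "deriv_power mero_deriv \<alpha> (u + v) = deriv_power mero_deriv \<alpha> u + deriv_power mero_deriv \<alpha> v" for \<alpha>
    by (induction \<alpha> rule: multi_index_induct; (subst (1 2 3) deriv_power_upd[of mero_deriv, OF mero_deriv_commute])?)
       (simp_all add: deriv_power_0 mero_deriv_add)
  then show ?thesis unfolding A(2) by (simp add: distrib_left sum.distrib)
qed

lemma diff_op_ring_simps [simp]:
  "carrier diff_op_ring = diff_ops" "mult diff_op_ring = (\<circ>)" "one diff_op_ring = id"
  "zero diff_op_ring = (\<lambda>_. 0)" "add diff_op_ring = (\<lambda>P Q u. P u + Q u)"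
  by (simp_all add: diff_op_ring_def)

lemma ring_diff_op_ring: "ring (diff_op_ring :: ('n::finite mero_germ \<Rightarrow> 'n mero_germ) ring)"
proof (rule ringI)
  show "abelian_group (diff_op_ring :: ('n mero_germ \<Rightarrow> 'n mero_germ) ring)"
  proof (rule abelian_groupI)
    fix P :: "'n mero_germ \<Rightarrow> 'n mero_germ" assume "P \<in> carrier diff_op_ring"
    then show "\<exists>Q\<in>carrier diff_op_ring. Q \<oplus>\<^bsub>diff_op_ring\<^esub> P = \<zero>\<^bsub>diff_op_ring\<^esub>"
      by (intro bexI[of _ "\<lambda>u. of_germ (- 1) * P u"]) (use diff_ops_mult[of P "- 1"] in \<open>simp_all add: of_germ_minus\<close>)
  qed (auto simp: add_ac intro: diff_ops_add diff_ops_zero)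
  show "monoid (diff_op_ring :: ('n mero_germ \<Rightarrow> 'n mero_germ) ring)"
    by (rule monoidI) (auto simp: comp_assoc intro: diff_ops_comp diff_ops_id)
qed (auto simp: fun_eq_iff diff_ops_apply_add)

section \<open>Left modules over noncommutative rings\<close>

locale left_ideal = additive_subgroup I R + ring R for I and R (structure) +
  assumes I_l_closed: "\<lbrakk>a \<in> I; x \<in> carrier R\<rbrakk> \<Longrightarrow> x \<otimes> a \<in> I"

definition gen_left_ideal :: "('a, 'm) ring_scheme \<Rightarrow> 'a set \<Rightarrow> 'a set" where
  "gen_left_ideal R S = \<Inter>{I. left_ideal I R \<and> S \<subseteq> I}"

locale left_module = R?: ring R + M?: abelian_group M for R (structure) and M (structure) +
  assumes smult_closed [simp, intro]:
      "\<lbrakk>a \<in> carrier R; x \<in> carrier M\<rbrakk> \<Longrightarrow> a \<odot>\<^bsub>M\<^esub> x \<in> carrier M"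
    and smult_l_distr:
      "\<lbrakk>a \<in> carrier R; b \<in> carrier R; x \<in> carrier M\<rbrakk> \<Longrightarrow>
      (a \<oplus> b) \<odot>\<^bsub>M\<^esub> x = a \<odot>\<^bsub>M\<^esub> x \<oplus>\<^bsub>M\<^esub> b \<odot>\<^bsub>M\<^esub> x"
    and smult_r_distr:
      "\<lbrakk>a \<in> carrier R; x \<in> carrier M; y \<in> carrier M\<rbrakk> \<Longrightarrow>
      a \<odot>\<^bsub>M\<^esub> (x \<oplus>\<^bsub>M\<^esub> y) = a \<odot>\<^bsub>M\<^esub> x \<oplus>\<^bsub>M\<^esub> a \<odot>\<^bsub>M\<^esub> y"
    and smult_assoc:
      "\<lbrakk>a \<in> carrier R; b \<in> carrier R; x \<in> carrier M\<rbrakk> \<Longrightarrow>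
      (a \<otimes> b) \<odot>\<^bsub>M\<^esub> x = a \<odot>\<^bsub>M\<^esub> (b \<odot>\<^bsub>M\<^esub> x)"
    and smult_one [simp]:
      "x \<in> carrier M \<Longrightarrow> \<one> \<odot>\<^bsub>M\<^esub> x = x"

definition left_module_isomorphic ::
  "('r, 'c) ring_scheme \<Rightarrow> ('r, 'a, 'd) module_scheme \<Rightarrow> ('r, 'b, 'e) module_scheme \<Rightarrow> bool" where
  "left_module_isomorphic R M N \<longleftrightarrow>
     (\<exists>h. bij_betw h (carrier M) (carrier N) \<and>
        (\<forall>x\<in>carrier M. \<forall>y\<in>carrier M. h (x \<oplus>\<^bsub>M\<^esub> y) = h x \<oplus>\<^bsub>N\<^esub> h y) \<and>
        (\<forall>r\<in>carrier R. \<forall>x\<in>carrier M. h (r \<odot>\<^bsub>M\<^esub> x) = r \<odot>\<^bsub>N\<^esub> h x))"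

text \<open>
  The record of modules extends that of rings; its multiplicative fields are not used.
\<close>

definition quot_module :: "('r, 'm) ring_scheme \<Rightarrow> 'r set \<Rightarrow> ('r, 'r set) module" where
  "quot_module R I =
     \<lparr>carrier = a_rcosets\<^bsub>R\<^esub> I, mult = undefined, one = undefined, zero = I, add = set_add R,
      smult = (\<lambda>r X. \<Union>x\<in>X. I +>\<^bsub>R\<^esub> (r \<otimes>\<^bsub>R\<^esub> x))\<rparr>"

lemma left_ideal_carrier:
  assumes "ring R" shows "left_ideal (carrier R) R"
proof -
  interpret ring R by fact
  show ?thesis
    by (intro left_ideal.intro left_ideal_axioms.intro additive_subgroupI ring_axioms
        add.subgroup_self) auto
qed

lemma left_ideal_gen_left_ideal:
  assumes "ring R" and S: "S \<subseteq> carrier R"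
  shows "left_ideal (gen_left_ideal R S) R" "S \<subseteq> gen_left_ideal R S"
    "left_ideal I R \<Longrightarrow> S \<subseteq> I \<Longrightarrow> gen_left_ideal R S \<subseteq> I"
proof -
  interpret ring R by fact
  let ?F = "{I. left_ideal I R \<and> S \<subseteq> I}"
  have ne: "?F \<noteq> {}" using left_ideal_carrier[OF assms(1)] S by blast
  have "subgroup (\<Inter>?F) (add_monoid R)"
    by (rule add.subgroups_Inter)
       (use ne left_ideal_def additive_subgroup_def in blast)+
  then show "left_ideal (gen_left_ideal R S) R"
    by (intro left_ideal.intro left_ideal_axioms.intro additive_subgroupI ring_axioms)
       (auto simp: gen_left_ideal_def left_ideal.I_l_closed)
qed (auto simp: gen_left_ideal_def)

lemma quot_module_smult:
  assumes "left_ideal I R" "r \<in> carrier R" "x \<in> carrier R"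
  shows "r \<odot>\<^bsub>quot_module R I\<^esub> (I +>\<^bsub>R\<^esub> x) = I +>\<^bsub>R\<^esub> (r \<otimes>\<^bsub>R\<^esub> x)"
proof -
  interpret left_ideal I R by fact
  interpret abelian_subgroup I R
    by (intro abelian_subgroupI3 is_additive_subgroup is_abelian_group)
  have 1: "I +>\<^bsub>R\<^esub> (r \<otimes>\<^bsub>R\<^esub> y) = I +>\<^bsub>R\<^esub> (r \<otimes>\<^bsub>R\<^esub> x)" if y: "y \<in> I +>\<^bsub>R\<^esub> x" for y
  proof -
    obtain a where a: "a \<in> I" "y = a \<oplus>\<^bsub>R\<^esub> x" using y unfolding a_r_coset_def' by blast
    have "r \<otimes>\<^bsub>R\<^esub> y = r \<otimes>\<^bsub>R\<^esub> a \<oplus>\<^bsub>R\<^esub> r \<otimes>\<^bsub>R\<^esub> x" using a assms by (simp add: r_distr)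
    moreover have "r \<otimes>\<^bsub>R\<^esub> a \<in> I" using a assms I_l_closed by blast
    ultimately have "r \<otimes>\<^bsub>R\<^esub> y \<in> I +>\<^bsub>R\<^esub> (r \<otimes>\<^bsub>R\<^esub> x)" unfolding a_r_coset_def' by blast
    from a_repr_independence'[OF this] show ?thesis using assms by simp
  qed
  have "x \<in> I +>\<^bsub>R\<^esub> x" using a_rcos_self assms by blast
  with 1 have "(\<Union>y\<in>I +>\<^bsub>R\<^esub> x. I +>\<^bsub>R\<^esub> (r \<otimes>\<^bsub>R\<^esub> y)) = I +>\<^bsub>R\<^esub> (r \<otimes>\<^bsub>R\<^esub> x)" by blast
  then show ?thesis by (simp add: quot_module_def)
qed

lemma left_module_quot_module:
  assumes "left_ideal I R"
  shows "left_module R (quot_module R I)"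
proof -
  interpret left_ideal I R by fact
  interpret abelian_subgroup I R
    by (intro abelian_subgroupI3 is_additive_subgroup is_abelian_group)
  let ?M = "quot_module R I"
  have car: "carrier ?M = {I +>\<^bsub>R\<^esub> x | x. x \<in> carrier R}"
    by (auto simp: quot_module_def A_RCOSETS_def')
  have add: "(I +>\<^bsub>R\<^esub> x) \<oplus>\<^bsub>?M\<^esub> (I +>\<^bsub>R\<^esub> y) = I +>\<^bsub>R\<^esub> (x \<oplus>\<^bsub>R\<^esub> y)"
    if "x \<in> carrier R" "y \<in> carrier R" for x y
    using that by (simp add: quot_module_def a_rcos_sum)
  have zero: "\<zero>\<^bsub>?M\<^esub> = I +>\<^bsub>R\<^esub> \<zero>\<^bsub>R\<^esub>"
    by (simp add: quot_module_def a_coset_add_zero a_subset)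
  note sm = quot_module_smult[OF assms]
  have "abelian_group ?M"
  proof (rule abelian_groupI)
    fix X assume "X \<in> carrier ?M"
    then obtain x where x: "X = I +>\<^bsub>R\<^esub> x" "x \<in> carrier R" unfolding car by blast
    show "\<exists>Y\<in>carrier ?M. Y \<oplus>\<^bsub>?M\<^esub> X = \<zero>\<^bsub>?M\<^esub>"
      by (rule bexI[of _ "I +>\<^bsub>R\<^esub> (\<ominus>\<^bsub>R\<^esub> x)"]) (use x in \<open>auto simp: add zero car l_neg\<close>)
  next
    fix X Y assume "X \<in> carrier ?M" "Y \<in> carrier ?M"
    then obtain x y where x: "X = I +>\<^bsub>R\<^esub> x" "x \<in> carrier R" "Y = I +>\<^bsub>R\<^esub> y" "y \<in> carrier R"
      unfolding car by blast
    show "X \<oplus>\<^bsub>?M\<^esub> Y \<in> carrier ?M" unfolding x add[OF x(2,4)] car using x by blast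
    show "X \<oplus>\<^bsub>?M\<^esub> Y = Y \<oplus>\<^bsub>?M\<^esub> X" using x by (simp add: add a_comm)
    fix Z assume "Z \<in> carrier ?M"
    then obtain z where z: "Z = I +>\<^bsub>R\<^esub> z" "z \<in> carrier R" unfolding car by blast
    show "X \<oplus>\<^bsub>?M\<^esub> Y \<oplus>\<^bsub>?M\<^esub> Z = X \<oplus>\<^bsub>?M\<^esub> (Y \<oplus>\<^bsub>?M\<^esub> Z)" using x z by (simp add: add a_assoc)
  next
    show "\<zero>\<^bsub>?M\<^esub> \<in> carrier ?M" unfolding zero car by blast
    fix X assume "X \<in> carrier ?M"
    then obtain x where x: "X = I +>\<^bsub>R\<^esub> x" "x \<in> carrier R" unfolding car by blast
    then show "\<zero>\<^bsub>?M\<^esub> \<oplus>\<^bsub>?M\<^esub> X = X" by (simp add: zero add)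
  qed
  moreover have "left_module_axioms R ?M"
  proof
    fix a b X assume ab: "a \<in> carrier R" "b \<in> carrier R" and "X \<in> carrier ?M"
    then obtain x where x: "X = I +>\<^bsub>R\<^esub> x" "x \<in> carrier R" unfolding car by blast
    show "(a \<oplus>\<^bsub>R\<^esub> b) \<odot>\<^bsub>?M\<^esub> X = a \<odot>\<^bsub>?M\<^esub> X \<oplus>\<^bsub>?M\<^esub> b \<odot>\<^bsub>?M\<^esub> X"
      using ab x by (simp add: sm add l_distr)
    show "(a \<otimes>\<^bsub>R\<^esub> b) \<odot>\<^bsub>?M\<^esub> X = a \<odot>\<^bsub>?M\<^esub> (b \<odot>\<^bsub>?M\<^esub> X)"
      using ab x by (simp add: sm m_assoc)
  next
    fix X assume "X \<in> carrier ?M"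
    then obtain x where x: "X = I +>\<^bsub>R\<^esub> x" "x \<in> carrier R" unfolding car by blast
    then show "\<one>\<^bsub>R\<^esub> \<odot>\<^bsub>?M\<^esub> X = X" by (simp add: sm)
  next
    fix a X assume a: "a \<in> carrier R" and "X \<in> carrier ?M"
    then obtain x where x: "X = I +>\<^bsub>R\<^esub> x" "x \<in> carrier R" unfolding car by blast
    show "a \<odot>\<^bsub>?M\<^esub> X \<in> carrier ?M" unfolding x(1) sm[OF a x(2)] car using a x by blast
    fix Y assume "Y \<in> carrier ?M"
    then obtain y where y: "Y = I +>\<^bsub>R\<^esub> y" "y \<in> carrier R" unfolding car by blast
    show "a \<odot>\<^bsub>?M\<^esub> (X \<oplus>\<^bsub>?M\<^esub> Y) = a \<odot>\<^bsub>?M\<^esub> X \<oplus>\<^bsub>?M\<^esub> a \<odot>\<^bsub>?M\<^esub> Y"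
      using a x y by (simp add: sm add r_distr)
  qed
  ultimately show ?thesis
    by (intro left_module.intro ring_axioms)
qed

section \<open>Uniqueness of the coefficients of a differential operator\<close>

lift_definition germ_coord :: "'n \<Rightarrow> 'n::finite hol_germ" is "\<lambda>i z. z $ i"
  by (simp add: germ_rel_def holomorphic_near0_def cdiff_coord)

lemma germ_deriv_coord: "germ_deriv i (germ_coord j) = (if i = j then 1 else 0)"
proof -
  have *: "pderiv_at i (\<lambda>z. z $ j) = (\<lambda>_. if i = j then 1 else 0)" for i j :: 'a
  proof
    fix z :: "complex ^ 'a"
    show "pderiv_at i (\<lambda>z. z $ j) z = (if i = j then 1 else 0)"
      by (subst pderiv_at_eq[where L = "\<lambda>v. v $ j"])
         (auto simp: axis_def intro!: bounded_linear_imp_has_derivative bounded_linear_vec_nth)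
  qed
  have "germ_deriv i (germ_coord j) = germ_const (if i = j then 1 else 0)"
    by transfer (simp add: germ_rel_def * holomorphic_near0_const)
  also have "\<dots> = (if i = j then 1 else 0)"
    by (cases "i = j") (transfer; simp add: germ_rel_def holomorphic_near0_const)+
  finally show ?thesis .
qed

lemma mero_deriv_of_nat [simp]: "mero_deriv i (of_nat m) = 0"
proof (induction m)
  case (Suc m)
  have "mero_deriv i 1 = 0" using mero_deriv_of_germ[of i 1] by simp
  with Suc show ?case by (simp add: mero_deriv_add)
qed simp

lemma mero_deriv_power:
  "mero_deriv i (u ^ m) = of_nat m * u ^ (m - 1) * mero_deriv i u"
proof (induction m)
  case 0
  then show ?case using mero_deriv_of_nat[of i 1] by simp
next
  case (Suc m)
  then show ?case by (cases m) (simp_all add: mero_deriv_mult algebra_simps)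
qed

lemma mero_deriv_minus: "mero_deriv i (- u) = - mero_deriv i u"
  using mero_deriv_add[of i u "- u"] by (simp add: minus_unique)

lemma mero_deriv_diff: "mero_deriv i (u - v) = mero_deriv i u - mero_deriv i v"
  using mero_deriv_add[of i u "- v"] by (simp add: mero_deriv_minus)

lemma mero_deriv_of_nat_mult: "mero_deriv i (of_nat m * u) = of_nat m * mero_deriv i u"
  by (simp add: mero_deriv_mult)

lemma of_germ_diff: "of_germ (a - b) = of_germ a - of_germ b"
  by (simp add: of_germ_def)

lemma of_germ_power: "of_germ (a ^ k) = of_germ a ^ k"
  by (induction k) (simp_all add: of_germ_mult)

lemma of_germ_of_nat: "of_germ (of_nat k) = of_nat k"
  by (simp add: of_germ_def of_nat_fract)

lemma germ_at0_add: "germ_at0 (a + b) = germ_at0 a + germ_at0 b"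
  by transfer simp

definition mero_monom :: "('n \<Rightarrow> nat) \<Rightarrow> 'n::finite mero_germ" where
  "mero_monom \<beta> = (\<Prod>i\<in>UNIV. of_germ (germ_coord i) ^ \<beta> i)"

lemma mero_deriv_monom:
  "mero_deriv i (mero_monom \<beta>) = of_nat (\<beta> i) * mero_monom (\<beta>(i := \<beta> i - 1))"
proof -
  let ?x = "\<lambda>j. of_germ (germ_coord j) :: 'a mero_germ"
  have d: "mero_deriv i (?x j) = (if i = j then 1 else 0)" for j
    by (simp add: mero_deriv_of_germ germ_deriv_coord)
  have z: "mero_deriv i (\<Prod>j\<in>A. ?x j ^ \<beta> j) = 0" if "finite A" "i \<notin> A" for A
    using that
  proof (induction A rule: finite_induct)
    case empty
    then show ?case using mero_deriv_of_nat[of i 1] by simp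
  next
    case (insert j A)
    then show ?case by (simp add: mero_deriv_mult mero_deriv_power d)
  qed
  have split: "mero_monom \<gamma> = ?x i ^ \<gamma> i * (\<Prod>j\<in>UNIV - {i}. ?x j ^ \<gamma> j)" for \<gamma>
    unfolding mero_monom_def by (simp add: prod.remove[of UNIV i])
  have same: "(\<Prod>j\<in>UNIV - {i}. ?x j ^ (\<beta>(i := \<beta> i - 1)) j) = (\<Prod>j\<in>UNIV - {i}. ?x j ^ \<beta> j)"
    by (rule prod.cong) auto
  show ?thesis
    unfolding split[of \<beta>] split[of "\<beta>(i := \<beta> i - 1)"] same
    by (simp add: mero_deriv_mult mero_deriv_power d z)
qed

lemma deriv_power_monom:
  "deriv_power mero_deriv \<gamma> (mero_monom \<beta>)
     = of_nat (\<Prod>i\<in>UNIV. \<Prod>j<\<gamma> i. \<beta> i - j) * mero_monom (\<lambda>i. \<beta> i - \<gamma> i)"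
proof (induction \<gamma> rule: multi_index_induct)
  case zero
  then show ?case by (simp add: deriv_power_0)
next
  case (step \<gamma> i)
  let ?p = "\<lambda>\<gamma> k. \<Prod>j<\<gamma> k. \<beta> k - j"
  have split: "(\<Prod>k\<in>UNIV. ?p \<gamma> k) = ?p \<gamma> i * (\<Prod>k\<in>UNIV - {i}. ?p \<gamma> k)" for \<gamma>
    by (simp add: prod.remove[of UNIV i])
  have same: "(\<Prod>k\<in>UNIV - {i}. ?p (\<gamma>(i := Suc (\<gamma> i))) k) = (\<Prod>k\<in>UNIV - {i}. ?p \<gamma> k)"
    by (rule prod.cong) auto
  have e: "(\<lambda>k. \<beta> k - (\<gamma>(i := Suc (\<gamma> i))) k) = (\<lambda>k. \<beta> k - \<gamma> k)(i := \<beta> i - \<gamma> i - 1)"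
    by (auto simp: fun_eq_iff)
  show ?case
    unfolding deriv_power_upd[of mero_deriv, OF mero_deriv_commute] comp_apply step.IH
      split[of "\<gamma>(i := Suc (\<gamma> i))"] same e mero_deriv_of_nat_mult mero_deriv_monom
    by (simp add: split[of \<gamma>] mult_ac del: of_nat_prod)
qed

lemma of_nat_mero_eq_0_iff: "(of_nat m :: 'n::finite mero_germ) = 0 \<longleftrightarrow> m = 0"
proof -
  have z: "germ_at0 (0 :: 'n hol_germ) = 0" by transfer simp
  have o: "germ_at0 (1 :: 'n hol_germ) = 1" by transfer simp
  have "germ_at0 (of_nat m :: 'n hol_germ) = of_nat m" for m
    by (induction m) (simp_all add: germ_at0_add z o)
  then have "(of_nat m :: 'n hol_germ) = 0 \<longleftrightarrow> m = 0" using z by (metis of_nat_0 of_nat_eq_0_iff)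
  then show ?thesis by (simp add: of_germ_of_nat[symmetric] of_germ_eq_0_iff)
qed

lemma diff_op_coeffs_unique:
  fixes a :: "('n::finite \<Rightarrow> nat) \<Rightarrow> 'n hol_germ"
  assumes "finite A" and zero: "diff_sum mero_deriv A (\<lambda>\<alpha>. of_germ (a \<alpha>)) = (\<lambda>_. 0)"
  shows "\<forall>\<alpha>\<in>A. a \<alpha> = 0"
proof (rule ccontr)
  assume "\<not> ?thesis"
  then obtain \<alpha>0 where "\<alpha>0 \<in> A \<and> a \<alpha>0 \<noteq> 0" by blast
  then obtain \<alpha> where \<alpha>: "\<alpha> \<in> A \<and> a \<alpha> \<noteq> 0"
    and min: "\<And>\<gamma>. \<gamma> \<in> A \<and> a \<gamma> \<noteq> 0 \<Longrightarrow> (\<Sum>i\<in>UNIV. \<alpha> i) \<le> (\<Sum>i\<in>UNIV. \<gamma> i)"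
    using ex_has_least_nat[of "\<lambda>\<gamma>. \<gamma> \<in> A \<and> a \<gamma> \<noteq> 0" \<alpha>0 "\<lambda>\<gamma>. \<Sum>i\<in>UNIV. \<gamma> i"] by blast
  have vanish: "of_germ (a \<gamma>) * deriv_power mero_deriv \<gamma> (mero_monom \<alpha>) = 0"
    if \<gamma>: "\<gamma> \<in> A - {\<alpha>}" for \<gamma>
  proof (cases "a \<gamma> = 0")
    case False
    have "\<exists>i. \<alpha> i < \<gamma> i"
    proof (rule ccontr)
      assume "\<not> ?thesis"
      then have le: "\<And>i. \<gamma> i \<le> \<alpha> i" by (simp add: not_less)
      moreover from this have "(\<Sum>i\<in>UNIV. \<gamma> i) \<le> (\<Sum>i\<in>UNIV. \<alpha> i)" by (intro sum_mono)
      with min[of \<gamma>] \<gamma> False have eq: "(\<Sum>i\<in>UNIV. \<gamma> i) = (\<Sum>i\<in>UNIV. \<alpha> i)" by auto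
      have "\<gamma> = \<alpha>"
      proof
        fix i show "\<gamma> i = \<alpha> i"
          using sum_strict_mono_ex1[of UNIV \<gamma> \<alpha>] le eq by (metis finite less_irrefl UNIV_I le_neq_implies_less)
      qed
      with \<gamma> show False by simp
    qed
    then obtain i where i: "\<alpha> i < \<gamma> i" by blast
    then have "(\<Prod>j<\<gamma> i. \<alpha> i - j) = 0" by (intro prod_zero) auto
    then have "(\<Prod>i\<in>UNIV. \<Prod>j<\<gamma> i. \<alpha> i - j) = 0" by (intro prod_zero) auto
    then show ?thesis by (simp only: deriv_power_monom of_nat_0 mult_zero_left mult_zero_right)
  qed simp
  have rest: "(\<Sum>\<gamma>\<in>A - {\<alpha>}. of_germ (a \<gamma>) * deriv_power mero_deriv \<gamma> (mero_monom \<alpha>)) = 0"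
    by (rule sum.neutral) (use vanish in blast)
  have "0 = diff_sum mero_deriv A (\<lambda>\<alpha>. of_germ (a \<alpha>)) (mero_monom \<alpha>)" by (simp add: zero)
  also have "\<dots> = of_germ (a \<alpha>) * deriv_power mero_deriv \<alpha> (mero_monom \<alpha>)"
    unfolding diff_sum_def
    using \<alpha> assms(1) rest sum.remove[of A \<alpha> "\<lambda>\<gamma>. of_germ (a \<gamma>) * deriv_power mero_deriv \<gamma> (mero_monom \<alpha>)"]
    by simp
  also have "\<dots> = of_germ (a \<alpha>) * of_nat (\<Prod>i\<in>UNIV. \<Prod>j<\<alpha> i. \<alpha> i - j)"
    unfolding deriv_power_monom by (simp add: mero_monom_def del: of_nat_prod)
  finally show False using \<alpha>
    by (simp add: of_germ_eq_0_iff of_nat_mero_eq_0_iff del: of_nat_prod)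
qed

section \<open>Logarithmic vector fields\<close>

text \<open>
  The module \<open>\<O>[1/f]\<close>, as a subset of the fraction field of the ring \<open>\<O>\<close> of holomorphic germs.
\<close>

definition mero_poles :: "'n::finite hol_germ \<Rightarrow> 'n mero_germ set" where
  "mero_poles f = {of_germ g / of_germ f ^ k | g k. True}"

definition mero_poles_module ::
  "'n::finite hol_germ \<Rightarrow> ('n mero_germ \<Rightarrow> 'n mero_germ, 'n mero_germ) module" where
  "mero_poles_module f =
     \<lparr>carrier = mero_poles f, mult = (*), one = 1, zero = 0, add = (+), smult = (\<lambda>P u. P u)\<rparr>"

definition annihilator :: "'n::finite mero_germ \<Rightarrow> ('n mero_germ \<Rightarrow> 'n mero_germ) set" where
  "annihilator u = {P \<in> diff_ops. P u = 0}"

definition vector_field :: "('n::finite \<Rightarrow> 'n hol_germ) \<Rightarrow> 'n mero_germ \<Rightarrow> 'n mero_germ" where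
  "vector_field v u = (\<Sum>i\<in>UNIV. of_germ (v i) * mero_deriv i u)"

definition log_derivations :: "'n::finite hol_germ \<Rightarrow> ('n mero_germ \<Rightarrow> 'n mero_germ) set" where
  "log_derivations f = {vector_field v | v. \<exists>a. vector_field v (of_germ f) = of_germ a * of_germ f}"

definition log_ideal :: "'n::finite hol_germ \<Rightarrow> nat \<Rightarrow> ('n mero_germ \<Rightarrow> 'n mero_germ) set" where
  "log_ideal f k = gen_left_ideal diff_op_ring
     {(\<lambda>u. \<delta> u + of_nat k * of_germ a * u) | \<delta> a.
        \<delta> \<in> log_derivations f \<and> \<delta> (of_germ f) = of_germ a * of_germ f}"

section \<open>The Bernstein--Sato polynomial\<close>

text \<open>
  A polynomial \<open>q\<close> in \<open>s\<close> with meromorphic coefficients stands for the symbol \<open>q f\<^sup>s\<close>, on which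
  \<open>\<partial>\<^sub>i\<close> acts by \<open>\<partial>\<^sub>i (q f\<^sup>s) = (\<partial>\<^sub>i q + s q (\<partial>\<^sub>i f) / f) f\<^sup>s\<close>. Lemma \<open>twisted_deriv_eval\<close> checks this
  against the specialisation at a negative integer.
\<close>

definition twisted_deriv :: "'n::finite hol_germ \<Rightarrow> 'n \<Rightarrow> 'n mero_germ poly \<Rightarrow> 'n mero_germ poly" where
  "twisted_deriv f i q =
     map_poly (mero_deriv i) q + [:0, mero_deriv i (of_germ f) / of_germ f:] * q"

text \<open>
  An element of \<open>\<D>[s]\<close> is written as a finite sum of terms \<open>a\<^sub>\<alpha> \<partial>\<^sup>\<alpha>\<close> with \<open>a\<^sub>\<alpha> \<in> \<O>[s]\<close>, since \<open>s\<close> is central.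
\<close>

definition diff_ops_s :: "'n::finite hol_germ \<Rightarrow> ('n mero_germ poly \<Rightarrow> 'n mero_germ poly) set" where
  "diff_ops_s f = {diff_sum (twisted_deriv f) A (\<lambda>\<alpha>. map_poly of_germ (a \<alpha>)) | A a. finite A}"

text \<open>
  The equation is \<open>P(s) f\<^sup>s\<^sup>+\<^sup>1 = b(s) f\<^sup>s\<close>, where \<open>f\<^sup>s\<^sup>+\<^sup>1 = f f\<^sup>s\<close> is represented by the constant
  polynomial \<open>f\<close>.
\<close>

definition bernstein_equation :: "'n::finite hol_germ \<Rightarrow> complex poly \<Rightarrow> bool" where
  "bernstein_equation f b \<longleftrightarrow>
     (\<exists>P\<in>diff_ops_s f. P [:of_germ f:] = map_poly (\<lambda>c. of_germ (germ_const c)) b)"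

definition is_b_function :: "'n::finite hol_germ \<Rightarrow> complex poly \<Rightarrow> bool" where
  "is_b_function f b \<longleftrightarrow> lead_coeff b = 1 \<and> bernstein_equation f b \<and>
     (\<forall>c. lead_coeff c = 1 \<and> bernstein_equation f c \<longrightarrow> degree b \<le> degree c)"

definition least_int_root :: "complex poly \<Rightarrow> int \<Rightarrow> bool" where
  "least_int_root b m \<longleftrightarrow>
     poly b (of_int m) = 0 \<and> (\<forall>k::int. poly b (of_int k) = 0 \<longrightarrow> m \<le> k)"

lemma mero_deriv_inverse_power:
  assumes "f \<noteq> 0"
  shows "mero_deriv i (of_germ g / of_germ f ^ k) =
     of_germ (germ_deriv i g * f - of_nat k * g * germ_deriv i f) / of_germ f ^ Suc k"
proof -
  have f: "of_germ f \<noteq> 0" using assms by (simp add: of_germ_eq_0_iff)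
  define u where "u = of_germ g / of_germ f ^ k"
  have "u * of_germ f ^ k = of_germ g" using f by (simp add: u_def)
  from arg_cong[OF this, of "mero_deriv i"]
  have "mero_deriv i u * of_germ f ^ k + u * (of_nat k * of_germ f ^ (k - 1) * of_germ (germ_deriv i f))
      = of_germ (germ_deriv i g)"
    by (simp add: mero_deriv_mult mero_deriv_power mero_deriv_of_germ)
  then have "mero_deriv i u * of_germ f ^ k =
      of_germ (germ_deriv i g) - u * (of_nat k * of_germ f ^ (k - 1) * of_germ (germ_deriv i f))"
    by (simp add: algebra_simps)
  then have "mero_deriv i u = (of_germ (germ_deriv i g) -
      u * (of_nat k * of_germ f ^ (k - 1) * of_germ (germ_deriv i f))) / of_germ f ^ k"
    using f by (simp add: eq_divide_eq)
  also have "\<dots> = of_germ (germ_deriv i g * f - of_nat k * g * germ_deriv i f) / of_germ f ^ Suc k"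
    using f by (cases k) (simp_all add: u_def field_simps of_germ_mult of_germ_diff of_germ_add of_germ_of_nat)
  finally show ?thesis by (simp add: u_def)
qed

lemma mero_poles_deriv: "f \<noteq> 0 \<Longrightarrow> u \<in> mero_poles f \<Longrightarrow> mero_deriv i u \<in> mero_poles f"
  unfolding mero_poles_def using mero_deriv_inverse_power by blast

lemma mero_poles_mult: "u \<in> mero_poles f \<Longrightarrow> of_germ g * u \<in> mero_poles f"
proof -
  assume "u \<in> mero_poles f"
  then obtain h k where "u = of_germ h / of_germ f ^ k" unfolding mero_poles_def by blast
  then have "of_germ g * u = of_germ (g * h) / of_germ f ^ k" by (simp add: of_germ_mult)
  then show ?thesis unfolding mero_poles_def by blast
qed

lemma mero_poles_add:
  assumes "f \<noteq> 0" "u \<in> mero_poles f" "v \<in> mero_poles f"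
  shows "u + v \<in> mero_poles f"
proof -
  have f: "of_germ f \<noteq> 0" using assms by (simp add: of_germ_eq_0_iff)
  obtain g k h l where "u = of_germ g / of_germ f ^ k" "v = of_germ h / of_germ f ^ l"
    using assms unfolding mero_poles_def by blast
  then have "u + v = of_germ (g * f ^ l + h * f ^ k) / of_germ f ^ (k + l)"
    using f by (simp add: of_germ_add of_germ_mult of_germ_power add_divide_distrib power_add)
  then show ?thesis unfolding mero_poles_def by blast
qed

lemma mero_poles_diff_op:
  assumes "f \<noteq> 0" "P \<in> diff_ops" "u \<in> mero_poles f"
  shows "P u \<in> mero_poles f"
proof -
  have z: "0 \<in> mero_poles f" using mero_poles_mult[OF assms(3), of 0] by simp
  have p: "deriv_power mero_deriv \<alpha> u \<in> mero_poles f" for \<alpha>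
  proof (induction \<alpha> rule: multi_index_induct)
    case zero
    then show ?case using assms by (simp add: deriv_power_0)
  next
    case (step \<alpha> i)
    show ?case unfolding deriv_power_upd[of mero_deriv, OF mero_deriv_commute] comp_apply
      by (rule mero_poles_deriv[OF assms(1) step])
  qed
  have s: "(\<Sum>x\<in>A. g x) \<in> mero_poles f" if "\<And>x. x \<in> A \<Longrightarrow> g x \<in> mero_poles f"
    for A :: "('a \<Rightarrow> nat) set" and g
    using that by (induction A rule: infinite_finite_induct) (simp_all add: z mero_poles_add[OF assms(1)])
  obtain A a where "P = (\<lambda>u. \<Sum>\<alpha>\<in>A. of_germ (a \<alpha>) * deriv_power mero_deriv \<alpha> u)"
    using assms(2) unfolding diff_ops_iff by blast
  then show ?thesis by (auto intro!: s mero_poles_mult p)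
qed

lemma left_module_mero_poles:
  assumes "f \<noteq> 0"
  shows "left_module diff_op_ring (mero_poles_module f)"
proof -
  have one: "1 \<in> mero_poles f" unfolding mero_poles_def
    by (auto intro!: exI[of _ 1] exI[of _ "0::nat"])
  have z: "0 \<in> mero_poles f" using mero_poles_mult[OF one, of 0] by simp
  have ab: "abelian_group (mero_poles_module f)"
  proof (rule abelian_groupI)
    fix u assume "u \<in> carrier (mero_poles_module f)"
    then show "\<exists>v\<in>carrier (mero_poles_module f). v \<oplus>\<^bsub>mero_poles_module f\<^esub> u = \<zero>\<^bsub>mero_poles_module f\<^esub>"
      using mero_poles_mult[of u f "- 1"]
      by (intro bexI[of _ "- u"]) (simp_all add: mero_poles_module_def of_germ_minus)
  qed (auto simp: mero_poles_module_def add_ac intro: mero_poles_add[OF assms] z)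
  show ?thesis
    by (intro left_module.intro ring_diff_op_ring ab left_module_axioms.intro)
       (auto simp: mero_poles_module_def diff_ops_apply_add intro: mero_poles_diff_op[OF assms])
qed

lemma log_ideal_left_ideal: "left_ideal (log_ideal f k) diff_op_ring"
  unfolding log_ideal_def
proof (rule left_ideal_gen_left_ideal(1)[OF ring_diff_op_ring], safe)
  fix \<delta> a assume "\<delta> \<in> log_derivations f"
  then obtain v where v: "\<delta> = vector_field v" unfolding log_derivations_def by blast
  have "(\<lambda>u. vector_field v u + of_germ (of_nat k * a) * u) \<in> diff_ops"
    unfolding vector_field_def
    by (intro diff_ops_add diff_ops_sum diff_ops_mult diff_ops_mero_deriv diff_ops_mult_op) auto
  then show "(\<lambda>u. \<delta> u + of_nat k * of_germ a * u) \<in> carrier diff_op_ring"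
    by (simp add: v of_germ_mult of_germ_of_nat)
qed

lemma twisted_deriv_eval:
  assumes "f \<noteq> 0"
  shows "mero_deriv i (poly q (- of_nat k) / of_germ f ^ k)
     = poly (twisted_deriv f i q) (- of_nat k) / of_germ f ^ k"
proof -
  have f: "of_germ f \<noteq> 0" using assms by (simp add: of_germ_eq_0_iff)
  have ev: "mero_deriv i (poly q (- of_nat k)) = poly (map_poly (mero_deriv i) q) (- of_nat k)"
    by (induction q) (simp_all add: map_poly_pCons mero_deriv_diff mero_deriv_of_nat_mult)
  have "mero_deriv i (1 / of_germ f ^ k) = - of_nat k * mero_deriv i (of_germ f) / of_germ f ^ Suc k"
    using mero_deriv_inverse_power[OF assms, of i 1 k]
    by (simp add: mero_deriv_of_germ of_germ_minus of_germ_mult of_germ_of_nat)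
  then have "mero_deriv i (poly q (- of_nat k) * (1 / of_germ f ^ k)) =
      poly (map_poly (mero_deriv i) q) (- of_nat k) * (1 / of_germ f ^ k) +
      poly q (- of_nat k) * (- of_nat k * mero_deriv i (of_germ f) / of_germ f ^ Suc k)"
    by (simp only: mero_deriv_mult ev)
  then show ?thesis using f by (simp add: twisted_deriv_def field_simps)
qed

lemma twisted_deriv_commute:
  assumes "f \<noteq> 0"
  shows "twisted_deriv f i (twisted_deriv f j q) = twisted_deriv f j (twisted_deriv f i q)"
proof -
  have f: "of_germ f \<noteq> 0" using assms by (simp add: of_germ_eq_0_iff)
  define l where "l = (\<lambda>i. mero_deriv i (of_germ f) / of_germ f)"
  have l: "mero_deriv i (of_germ f) = l i * of_germ f" for i using f by (simp add: l_def)
  have "mero_deriv i (mero_deriv j (of_germ f)) = (mero_deriv i (l j) + l j * l i) * of_germ f" for i j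
    unfolding l[of j] mero_deriv_mult l[of i] by (simp add: algebra_simps)
  from this[of i j] this[of j i] mero_deriv_commute[of i j "of_germ f"] f
  have sym: "mero_deriv i (l j) = mero_deriv j (l i)" by (simp add: mult.commute)
  have cf: "coeff (twisted_deriv f i q) m =
      mero_deriv i (coeff q m) + (case m of 0 \<Rightarrow> 0 | Suc m' \<Rightarrow> l i * coeff q m')" for i q m
    by (cases m) (simp_all add: twisted_deriv_def coeff_map_poly l_def)
  show ?thesis
  proof (rule poly_eqI)
    fix m show "coeff (twisted_deriv f i (twisted_deriv f j q)) m = coeff (twisted_deriv f j (twisted_deriv f i q)) m"
    proof (cases m)
      case 0
      then show ?thesis by (simp add: cf mero_deriv_commute[of i j])
    next
      case (Suc m')
      then show ?thesis
        by (cases m') (simp_all add: cf mero_deriv_commute[of i j] mero_deriv_add mero_deriv_mult sym algebra_simps)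
    qed
  qed
qed

end

theory Submission
  imports Defs
begin

text \<open>
  Both sides of the equivalence are statements about one generator. A left module is isomorphic to
  \<open>\<D> / I\<close> exactly when it has a generator with annihilator \<open>I\<close>
  (\<open>isomorphic_quot_module_iff\<close>), so the question is which elements \<open>u\<close> can serve as such a
  generator of \<open>\<O>[*D]\<close> when \<open>I\<close> is the logarithmic ideal.

  That \<open>1 / f\<^sup>k\<close>, with \<open>-k\<close> the least integer root of \<open>b\<close>, generates \<open>\<O>[*D]\<close> is the classical use
  of the \<open>b\<close>-function: at \<open>s = -m\<close> the functional equation reads
  \<open>P(-m) (1 / f\<^sup>m\<^sup>-\<^sup>1) = b(-m) / f\<^sup>m\<close>, and \<open>b(-m) \<noteq> 0\<close> for \<open>m > k\<close>, so every further pole order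
  is reached (\<open>generated_by_inverse_power\<close>). Hence equality of the two ideals gives the isomorphism.

  Conversely, let \<open>u\<close> be a generator whose annihilator is the logarithmic ideal. This ideal contains the
  operators \<open>f \<partial>\<^sub>i + k \<partial>\<^sub>i f\<close>, because \<open>f \<partial>\<^sub>i\<close> is always a logarithmic vector field. They say
  that \<open>h = u f\<^sup>k\<close> is killed by every \<open>\<partial>\<^sub>i\<close>, so that every differential operator commutes with
  multiplication by \<open>h\<close>. As \<open>h\<close> is a nonzero element of a field, \<open>u = h / f\<^sup>k\<close> and \<open>1 / f\<^sup>k\<close> have
  the same annihilator (\<open>annihilator_eq_annihilator_inverse_power\<close>). Thus an abstract isomorphism
  already forces the annihilator of \<open>1 / f\<^sup>k\<close> to be the logarithmic ideal.
\<close>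

section \<open>Cyclic left modules\<close>

text \<open>
  The generator is the element corresponding to the class of \<open>1\<close>; in the other direction the
  isomorphism sends \<open>x\<close> to the set of all \<open>r\<close> with \<open>r u = x\<close>, which is a coset of the annihilator.
\<close>

lemma isomorphic_quot_module_iff:
  assumes M: "left_module R M" and I: "left_ideal I R"
  shows "left_module_isomorphic R M (quot_module R I) \<longleftrightarrow>
     (\<exists>u\<in>carrier M. (\<forall>x\<in>carrier M. \<exists>r\<in>carrier R. r \<odot>\<^bsub>M\<^esub> u = x) \<and>
        {r \<in> carrier R. r \<odot>\<^bsub>M\<^esub> u = \<zero>\<^bsub>M\<^esub>} = I)"
proof -
  interpret left_module R M by fact
  interpret I: left_ideal I R by fact
  interpret I: abelian_subgroup I R
    by (intro abelian_subgroupI3 I.is_additive_subgroup R.is_abelian_group)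
  let ?Q = "quot_module R I"
  have car: "carrier ?Q = {I +>\<^bsub>R\<^esub> x | x. x \<in> carrier R}"
    by (auto simp: quot_module_def A_RCOSETS_def')
  have add: "(I +>\<^bsub>R\<^esub> x) \<oplus>\<^bsub>?Q\<^esub> (I +>\<^bsub>R\<^esub> y) = I +>\<^bsub>R\<^esub> (x \<oplus>\<^bsub>R\<^esub> y)"
    if "x \<in> carrier R" "y \<in> carrier R" for x y
    using that by (simp add: quot_module_def I.a_rcos_sum)
  note sm = quot_module_smult[OF I]
  have coset_eq: "I +>\<^bsub>R\<^esub> r = I \<longleftrightarrow> r \<in> I" if "r \<in> carrier R" for r
    using that I.a_rcos_const I.a_rcos_self by blast
  have zero_smult: "\<zero>\<^bsub>R\<^esub> \<odot>\<^bsub>M\<^esub> u = \<zero>\<^bsub>M\<^esub>" if u: "u \<in> carrier M" for u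
  proof -
    have "\<zero>\<^bsub>R\<^esub> \<odot>\<^bsub>M\<^esub> u \<oplus>\<^bsub>M\<^esub> \<zero>\<^bsub>R\<^esub> \<odot>\<^bsub>M\<^esub> u = \<zero>\<^bsub>R\<^esub> \<odot>\<^bsub>M\<^esub> u"
      using smult_l_distr[OF R.zero_closed R.zero_closed u] by simp
    then show ?thesis using u by (simp add: M.add.l_cancel_one)
  qed
  show ?thesis
  proof
    assume "left_module_isomorphic R M ?Q"
    then obtain h where bij: "bij_betw h (carrier M) (carrier ?Q)"
      and lin: "\<And>r x. r \<in> carrier R \<Longrightarrow> x \<in> carrier M \<Longrightarrow> h (r \<odot>\<^bsub>M\<^esub> x) = r \<odot>\<^bsub>?Q\<^esub> h x"
      unfolding left_module_isomorphic_def by blast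
    have "I +>\<^bsub>R\<^esub> \<one>\<^bsub>R\<^esub> \<in> h ` carrier M"
      using bij unfolding bij_betw_def car by auto
    then obtain u where u: "u \<in> carrier M" "h u = I +>\<^bsub>R\<^esub> \<one>\<^bsub>R\<^esub>" by auto
    have hr: "h (r \<odot>\<^bsub>M\<^esub> u) = I +>\<^bsub>R\<^esub> r" if "r \<in> carrier R" for r
      using that u by (simp add: lin sm)
    have inj: "x = y" if "h x = h y" "x \<in> carrier M" "y \<in> carrier M" for x y
      using that bij by (auto simp: bij_betw_def dest: inj_onD)
    have "\<exists>r\<in>carrier R. r \<odot>\<^bsub>M\<^esub> u = x" if x: "x \<in> carrier M" for x
    proof -
      have "h x \<in> carrier ?Q" using bij x by (auto simp: bij_betw_def)
      then obtain r where r: "r \<in> carrier R" "h x = I +>\<^bsub>R\<^esub> r" unfolding car by blast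
      then have "r \<odot>\<^bsub>M\<^esub> u = x" using hr[of r] u x by (intro inj) auto
      with r show ?thesis by blast
    qed
    moreover have "r \<odot>\<^bsub>M\<^esub> u = \<zero>\<^bsub>M\<^esub> \<longleftrightarrow> r \<in> I" if r: "r \<in> carrier R" for r
    proof -
      have h0: "h \<zero>\<^bsub>M\<^esub> = I"
        using hr[of "\<zero>\<^bsub>R\<^esub>"] u by (simp add: zero_smult coset_eq)
      have "r \<odot>\<^bsub>M\<^esub> u = \<zero>\<^bsub>M\<^esub> \<longleftrightarrow> h (r \<odot>\<^bsub>M\<^esub> u) = h \<zero>\<^bsub>M\<^esub>" using inj r u by auto
      then show ?thesis using r by (simp add: h0 hr coset_eq)
    qed
    ultimately show "\<exists>u\<in>carrier M. (\<forall>x\<in>carrier M. \<exists>r\<in>carrier R. r \<odot>\<^bsub>M\<^esub> u = x) \<and>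
        {r \<in> carrier R. r \<odot>\<^bsub>M\<^esub> u = \<zero>\<^bsub>M\<^esub>} = I"
      using u(1) I.a_subset by (intro bexI[of _ u]) auto
  next
    assume "\<exists>u\<in>carrier M. (\<forall>x\<in>carrier M. \<exists>r\<in>carrier R. r \<odot>\<^bsub>M\<^esub> u = x) \<and>
        {r \<in> carrier R. r \<odot>\<^bsub>M\<^esub> u = \<zero>\<^bsub>M\<^esub>} = I"
    then obtain u where u: "u \<in> carrier M"
      and gen: "\<And>x. x \<in> carrier M \<Longrightarrow> \<exists>r\<in>carrier R. r \<odot>\<^bsub>M\<^esub> u = x"
      and ann: "\<And>r. r \<in> carrier R \<Longrightarrow> r \<in> I \<longleftrightarrow> r \<odot>\<^bsub>M\<^esub> u = \<zero>\<^bsub>M\<^esub>" by blast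
    define h where "h = (\<lambda>x. {r \<in> carrier R. r \<odot>\<^bsub>M\<^esub> u = x})"
    have hr: "h (s \<odot>\<^bsub>M\<^esub> u) = I +>\<^bsub>R\<^esub> s" if s: "s \<in> carrier R" for s
    proof (intro equalityI subsetI)
      fix r assume "r \<in> h (s \<odot>\<^bsub>M\<^esub> u)"
      then have r: "r \<in> carrier R" "r \<odot>\<^bsub>M\<^esub> u = s \<odot>\<^bsub>M\<^esub> u" by (auto simp: h_def)
      have dec: "r = (r \<ominus>\<^bsub>R\<^esub> s) \<oplus>\<^bsub>R\<^esub> s" using r s by (simp add: R.minus_eq R.a_assoc R.l_neg)
      have "(r \<ominus>\<^bsub>R\<^esub> s) \<odot>\<^bsub>M\<^esub> u \<oplus>\<^bsub>M\<^esub> s \<odot>\<^bsub>M\<^esub> u = s \<odot>\<^bsub>M\<^esub> u"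
        using smult_l_distr[of "r \<ominus>\<^bsub>R\<^esub> s" s u] dec r s u by simp
      then have "(r \<ominus>\<^bsub>R\<^esub> s) \<odot>\<^bsub>M\<^esub> u = \<zero>\<^bsub>M\<^esub>"
        using r s u by (simp add: M.add.l_cancel_one)
      then have "r \<ominus>\<^bsub>R\<^esub> s \<in> I" using ann r s by simp
      with dec show "r \<in> I +>\<^bsub>R\<^esub> s" unfolding a_r_coset_def' by blast
    next
      fix r assume "r \<in> I +>\<^bsub>R\<^esub> s"
      then obtain a where a: "a \<in> I" "r = a \<oplus>\<^bsub>R\<^esub> s" unfolding a_r_coset_def' by blast
      have "a \<in> carrier R" using a I.a_subset by blast
      with a s u ann[of a] show "r \<in> h (s \<odot>\<^bsub>M\<^esub> u)" by (simp add: h_def smult_l_distr)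
    qed
    have "inj_on h (carrier M)"
      by (rule inj_onI) (use gen in \<open>fastforce simp: h_def\<close>)
    moreover have "h ` carrier M = carrier ?Q"
    proof (intro equalityI subsetI)
      fix X assume "X \<in> h ` carrier M"
      then obtain r where "r \<in> carrier R" "X = h (r \<odot>\<^bsub>M\<^esub> u)" using gen by blast
      then show "X \<in> carrier ?Q" unfolding car using hr by blast
    next
      fix X assume "X \<in> carrier ?Q"
      then obtain r where "r \<in> carrier R" "X = I +>\<^bsub>R\<^esub> r" unfolding car by blast
      then show "X \<in> h ` carrier M" using hr u by (intro image_eqI[of _ _ "r \<odot>\<^bsub>M\<^esub> u"]) auto
    qed
    moreover have "h (x \<oplus>\<^bsub>M\<^esub> y) = h x \<oplus>\<^bsub>?Q\<^esub> h y" if xy: "x \<in> carrier M" "y \<in> carrier M" for x y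
    proof -
      obtain r where r: "r \<in> carrier R" "r \<odot>\<^bsub>M\<^esub> u = x" using gen[OF xy(1)] by blast
      obtain s where s: "s \<in> carrier R" "s \<odot>\<^bsub>M\<^esub> u = y" using gen[OF xy(2)] by blast
      have "(r \<oplus>\<^bsub>R\<^esub> s) \<odot>\<^bsub>M\<^esub> u = x \<oplus>\<^bsub>M\<^esub> y" using u r s by (simp add: smult_l_distr)
      then show ?thesis using hr[of r] hr[of s] hr[of "r \<oplus>\<^bsub>R\<^esub> s"] r s by (simp add: add)
    qed
    moreover have "h (s \<odot>\<^bsub>M\<^esub> x) = s \<odot>\<^bsub>?Q\<^esub> h x" if sx: "s \<in> carrier R" "x \<in> carrier M" for s x
    proof -
      obtain r where r: "r \<in> carrier R" "r \<odot>\<^bsub>M\<^esub> u = x" using gen[OF sx(2)] by blast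
      have "(s \<otimes>\<^bsub>R\<^esub> r) \<odot>\<^bsub>M\<^esub> u = s \<odot>\<^bsub>M\<^esub> x" using u r sx by (simp add: smult_assoc)
      then show ?thesis using hr[of r] hr[of "s \<otimes>\<^bsub>R\<^esub> r"] r sx by (simp add: sm)
    qed
    ultimately show "left_module_isomorphic R M ?Q"
      unfolding left_module_isomorphic_def bij_betw_def
      by (intro exI[of _ h] conjI ballI)
  qed
qed

section \<open>Solutions of the logarithmic operators\<close>

lemma diff_ops_apply_zero: "P \<in> diff_ops \<Longrightarrow> P 0 = 0"
  using diff_ops_apply_add[of P 0 0] by (metis add_cancel_right_right)

lemma diff_ops_commute_constant:
  assumes const: "\<And>i. mero_deriv i h = 0" and P: "P \<in> diff_ops"
  shows "P (h * u) = h * P u"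
proof -
  have pow: "deriv_power mero_deriv \<alpha> (h * u) = h * deriv_power mero_deriv \<alpha> u" for \<alpha>
  proof (induction \<alpha> rule: multi_index_induct)
    case zero
    then show ?case by (simp add: deriv_power_0)
  next
    case (step \<alpha> i)
    then show ?case
      unfolding deriv_power_upd[of mero_deriv, OF mero_deriv_commute] comp_apply
      by (simp add: mero_deriv_mult const)
  qed
  obtain A a where "P = (\<lambda>u. \<Sum>\<alpha>\<in>A. of_germ (a \<alpha>) * deriv_power mero_deriv \<alpha> u)"
    using P unfolding diff_ops_iff by blast
  then show ?thesis by (simp add: pow sum_distrib_left mult.left_commute)
qed

text \<open>The field \<open>f \<partial>\<^sub>i\<close> is logarithmic, with factor \<open>\<partial>\<^sub>i f\<close>.\<close>

lemma log_ideal_coordinate_operator: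
  "(\<lambda>u. of_germ f * mero_deriv i u + of_nat k * of_germ (germ_deriv i f) * u) \<in> log_ideal f k"
proof -
  let ?v = "\<lambda>j. if j = i then f else 0"
  have v: "vector_field ?v u = of_germ f * mero_deriv i u" for u
    unfolding vector_field_def by (subst sum.remove[of _ i]) auto
  have vf: "vector_field ?v (of_germ f) = of_germ (germ_deriv i f) * of_germ f"
    by (simp add: v mero_deriv_of_germ)
  have "vector_field ?v \<in> log_derivations f"
    unfolding log_derivations_def using vf by blast
  then have "(\<lambda>u. vector_field ?v u + of_nat k * of_germ (germ_deriv i f) * u) \<in> log_ideal f k"
    unfolding log_ideal_def gen_left_ideal_def using vf by blast
  then show ?thesis by (simp only: v)
qed

text \<open>
  The first-order operators above determine a solution up to a factor killed by all derivations,
  and such a factor does not change the annihilator.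
\<close>

lemma annihilator_eq_annihilator_inverse_power:
  assumes f: "f \<noteq> 0" and u: "u \<noteq> 0" and ann: "log_ideal f k \<subseteq> annihilator u"
  shows "annihilator u = annihilator (1 / of_germ f ^ k)"
proof -
  have F: "of_germ f \<noteq> 0" using f by (simp add: of_germ_eq_0_iff)
  define h where "h = u * of_germ f ^ k"
  have "mero_deriv i h = 0" for i
  proof -
    have sol: "of_germ f * mero_deriv i u + of_nat k * of_germ (germ_deriv i f) * u = 0"
      using log_ideal_coordinate_operator[of f i k] ann unfolding annihilator_def by blast
    have "of_germ f * mero_deriv i h =
        of_germ f ^ k * (of_germ f * mero_deriv i u + of_nat k * of_germ (germ_deriv i f) * u)"
      unfolding h_def mero_deriv_mult mero_deriv_power mero_deriv_of_germ
      by (cases k) (simp_all add: algebra_simps)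
    with sol F show ?thesis by simp
  qed
  then have Pu: "P u = h * P (1 / of_germ f ^ k)" if "P \<in> diff_ops" for P
    using diff_ops_commute_constant[of h P "1 / of_germ f ^ k"] that F by (simp add: h_def)
  have "h \<noteq> 0" using u F by (simp add: h_def)
  then have "P u = 0 \<longleftrightarrow> P (1 / of_germ f ^ k) = 0" if "P \<in> diff_ops" for P
    unfolding Pu[OF that] by simp
  then show ?thesis unfolding annihilator_def by blast
qed

section \<open>Generation by a power of the inverse equation\<close>

lemma germ_const_ring_hom:
  "germ_const 0 = 0" "germ_const 1 = 1"
  "germ_const (c + d) = germ_const c + germ_const d"
  "germ_const (c * d) = germ_const c * germ_const d"
  by (transfer; simp add: germ_rel_def holomorphic_near0_const)+

lemma germ_const_of_nat: "germ_const (of_nat m) = of_nat m"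
  by (induction m) (simp_all add: germ_const_ring_hom)

lemma germ_const_minus: "germ_const (- c) = - germ_const c"
  using germ_const_ring_hom(3)[of "- c" c] by (simp add: germ_const_ring_hom(1) eq_neg_iff_add_eq_0)

lemma poly_map_germ_const:
  "poly (map_poly (\<lambda>c. of_germ (germ_const c)) b) (of_germ (germ_const z)) =
     of_germ (germ_const (poly b z))"
  by (induction b) (simp_all add: map_poly_pCons germ_const_ring_hom of_germ_add of_germ_mult)

lemma poly_map_of_germ: "poly (map_poly of_germ p) (of_germ c) = of_germ (poly p c)"
  by (induction p) (simp_all add: map_poly_pCons of_germ_add of_germ_mult)

lemma deriv_power_twisted_eval:
  assumes "f \<noteq> 0"
  shows "poly (deriv_power (twisted_deriv f) \<alpha> q) (- of_nat m) / of_germ f ^ m =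
     deriv_power mero_deriv \<alpha> (poly q (- of_nat m) / of_germ f ^ m)"
proof (induction \<alpha> rule: multi_index_induct)
  case zero
  then show ?case by (simp add: deriv_power_0)
next
  case (step \<alpha> i)
  show ?case
    unfolding deriv_power_upd[of "twisted_deriv f", OF twisted_deriv_commute[OF assms]]
      deriv_power_upd[of mero_deriv, OF mero_deriv_commute] comp_apply
      twisted_deriv_eval[OF assms, symmetric] step.IH ..
qed

text \<open>The specialisation \<open>s = -m\<close> of an operator in \<open>\<D>[s]\<close>.\<close>

lemma diff_ops_s_eval:
  assumes f: "f \<noteq> 0" and P: "P \<in> diff_ops_s f"
  shows "\<exists>Q\<in>diff_ops. \<forall>q. Q (poly q (- of_nat m) / of_germ f ^ m) = poly (P q) (- of_nat m) / of_germ f ^ m"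
proof -
  obtain A a where A: "finite A" and P: "P = diff_sum (twisted_deriv f) A (\<lambda>\<alpha>. map_poly of_germ (a \<alpha>))"
    using P unfolding diff_ops_s_def by blast
  define Q where "Q = (\<lambda>u. \<Sum>\<alpha>\<in>A. of_germ (poly (a \<alpha>) (- of_nat m)) * deriv_power mero_deriv \<alpha> u)"
  have "Q \<in> diff_ops" unfolding Q_def by (intro diff_ops_sum A diff_ops_monom)
  moreover have "Q (poly q (- of_nat m) / of_germ f ^ m) = poly (P q) (- of_nat m) / of_germ f ^ m" for q
  proof -
    have ev: "poly (map_poly of_germ p) (- of_nat m) = of_germ (poly p (- of_nat m))" for p :: "'a hol_germ poly"
      using poly_map_of_germ[of p "- of_nat m"] by (simp add: of_germ_minus of_germ_of_nat)
    show ?thesis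
      unfolding P Q_def diff_sum_def poly_sum poly_mult ev sum_divide_distrib
        deriv_power_twisted_eval[OF f, symmetric] by simp
  qed
  ultimately show ?thesis by blast
qed

text \<open>The functional equation at \<open>s = -(m + 1)\<close>, divided by \<open>b(-(m + 1))\<close>.\<close>

lemma bernstein_raise_pole_order:
  assumes f: "f \<noteq> 0" and b: "bernstein_equation f b" and nz: "poly b (- of_nat (Suc m)) \<noteq> 0"
  shows "\<exists>P\<in>diff_ops. P (1 / of_germ f ^ m) = 1 / of_germ f ^ Suc m"
proof -
  let ?s = "- of_nat (Suc m) :: complex"
  have F: "of_germ f \<noteq> 0" using f by (simp add: of_germ_eq_0_iff)
  obtain P where P: "P \<in> diff_ops_s f"
    "P [:of_germ f:] = map_poly (\<lambda>c. of_germ (germ_const c)) b"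
    using b unfolding bernstein_equation_def by blast
  obtain Q where Q: "Q \<in> diff_ops"
    "\<And>q. Q (poly q (- of_nat (Suc m)) / of_germ f ^ Suc m) = poly (P q) (- of_nat (Suc m)) / of_germ f ^ Suc m"
    using diff_ops_s_eval[OF f P(1), of "Suc m"] by blast
  have bs: "poly (map_poly (\<lambda>c. of_germ (germ_const c)) b) (- of_nat (Suc m)) = of_germ (germ_const (poly b ?s))"
    using poly_map_germ_const[of b ?s] by (simp only: germ_const_minus germ_const_of_nat of_germ_minus of_germ_of_nat)
  define c where "c = poly b ?s"
  have "Q (1 / of_germ f ^ m) = of_germ (germ_const c) / of_germ f ^ Suc m"
    using Q(2)[of "[:of_germ f:]"] F unfolding P(2) bs c_def[symmetric] by simp
  moreover have "of_germ (germ_const (1 / c)) * of_germ (germ_const c) = 1"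
  proof -
    have "germ_const (1 / c) * germ_const c = 1"
      using nz unfolding germ_const_ring_hom(4)[symmetric] c_def by (simp add: germ_const_ring_hom(2))
    then show ?thesis by (metis of_germ_mult of_germ_1)
  qed
  ultimately have "of_germ (germ_const (1 / c)) * Q (1 / of_germ f ^ m) = 1 / of_germ f ^ Suc m"
    by (metis times_divide_eq_right)
  then show ?thesis
    using diff_ops_mult[OF Q(1), of "germ_const (1 / c)"] by (rule bexI)
qed

lemma generated_by_inverse_power:
  assumes f: "f \<noteq> 0" and b: "bernstein_equation f b" and root: "least_int_root b (- int k)"
    and u: "u \<in> mero_poles f"
  shows "\<exists>P\<in>diff_ops. P (1 / of_germ f ^ k) = u"
proof -
  have F: "of_germ f \<noteq> 0" using f by (simp add: of_germ_eq_0_iff)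
  have high: "\<exists>P\<in>diff_ops. P (1 / of_germ f ^ k) = 1 / of_germ f ^ (k + j)" for j
  proof (induction j)
    case 0
    then show ?case using diff_ops_id by (intro bexI[of _ id]) auto
  next
    case (Suc j)
    then obtain P where P: "P \<in> diff_ops" "P (1 / of_germ f ^ k) = 1 / of_germ f ^ (k + j)" by blast
    have "poly b (of_int (- int (Suc (k + j)))) \<noteq> 0"
    proof
      assume "poly b (of_int (- int (Suc (k + j)))) = 0"
      then have "- int k \<le> - int (Suc (k + j))"
        using root unfolding least_int_root_def by blast
      then show False by simp
    qed
    then obtain Q where Q: "Q \<in> diff_ops" "Q (1 / of_germ f ^ (k + j)) = 1 / of_germ f ^ Suc (k + j)"
      using bernstein_raise_pole_order[OF f b, of "k + j"] by auto
    show ?case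
      by (rule bexI[of _ "Q \<circ> P"]) (use P Q in \<open>auto intro: diff_ops_comp\<close>)
  qed
  obtain g m where u: "u = of_germ g / of_germ f ^ m" using u unfolding mero_poles_def by blast
  obtain P where P: "P \<in> diff_ops" "P (1 / of_germ f ^ k) = 1 / of_germ f ^ (k + m)" using high by blast
  \<comment> \<open>Going up to the pole order \<open>k + m\<close> avoids comparing \<open>m\<close> with \<open>k\<close>; multiplying by \<open>f\<^sup>k\<close>
    comes back down.\<close>
  have "u = of_germ (g * f ^ k) * (1 / of_germ f ^ (k + m))"
    using F by (simp add: u of_germ_mult of_germ_power power_add)
  then show ?thesis
    using diff_ops_mult[OF P(1), of "g * f ^ k"] P(2) by (intro bexI) auto
qed

theorem mainTheorem1:
  fixes f :: "'n::finite hol_germ" and b :: "complex poly" and \<alpha>\<^sub>0 :: nat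
  assumes "f \<noteq> 0" and "germ_at0 f = 0" and "squarefree f"
    and "is_b_function f b"
    and "least_int_root b (- int \<alpha>\<^sub>0)"
  shows "left_module_isomorphic diff_op_ring
           (mero_poles_module f) (quot_module diff_op_ring (log_ideal f \<alpha>\<^sub>0))
     \<longleftrightarrow> annihilator (1 / of_germ f ^ \<alpha>\<^sub>0) = log_ideal f \<alpha>\<^sub>0"
proof -
  let ?w = "1 / of_germ f ^ \<alpha>\<^sub>0"
  have b: "bernstein_equation f b" using assms(4) by (simp add: is_b_function_def)
  have iso: "left_module_isomorphic diff_op_ring
        (mero_poles_module f) (quot_module diff_op_ring (log_ideal f \<alpha>\<^sub>0)) \<longleftrightarrow>
     (\<exists>u\<in>mero_poles f. (\<forall>x\<in>mero_poles f. \<exists>P\<in>diff_ops. P u = x) \<and>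
        annihilator u = log_ideal f \<alpha>\<^sub>0)"
    using isomorphic_quot_module_iff[OF left_module_mero_poles[OF assms(1)] log_ideal_left_ideal]
    by (simp add: mero_poles_module_def annihilator_def)
  have inverse_power: "1 / of_germ f ^ k \<in> mero_poles f" for k
    unfolding mero_poles_def by (auto intro!: exI[of _ 1] exI[of _ k])
  show ?thesis unfolding iso
  proof
    assume "\<exists>u\<in>mero_poles f. (\<forall>x\<in>mero_poles f. \<exists>P\<in>diff_ops. P u = x) \<and>
        annihilator u = log_ideal f \<alpha>\<^sub>0"
    then obtain u where gen: "\<And>x. x \<in> mero_poles f \<Longrightarrow> \<exists>P\<in>diff_ops. P u = x"
      and ann: "annihilator u = log_ideal f \<alpha>\<^sub>0" by blast
    have "u \<noteq> 0"
      using gen[OF inverse_power[of 0]] diff_ops_apply_zero by force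
    then show "annihilator ?w = log_ideal f \<alpha>\<^sub>0"
      using annihilator_eq_annihilator_inverse_power[OF assms(1)] ann by blast
  next
    assume "annihilator ?w = log_ideal f \<alpha>\<^sub>0"
    then show "\<exists>u\<in>mero_poles f. (\<forall>x\<in>mero_poles f. \<exists>P\<in>diff_ops. P u = x) \<and>
        annihilator u = log_ideal f \<alpha>\<^sub>0"
      using generated_by_inverse_power[OF assms(1) b assms(5)] inverse_power
      by (intro bexI[of _ ?w]) auto
  qed
qed

end
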